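(* Let $\lambda\in\mathbb{C}\setminus 2\mathbb{Z}$. Then the $\mathfrak{sl}_2(\mathbb{C})$-module $M_\lambda^C=U(I_\lambda)/U(I_\lambda)C$ is simple.
   Context: Let $x=\begin{bmatrix}0&1\\0&0\end{bmatrix}$, $h=\begin{bmatrix}1&0\\0&-1\end{bmatrix}$, $y=\begin{bmatrix}0&0\\1&0\end{bmatrix}$ be the standard basis of $\mathfrak{sl}_2(\mathbb{C})$ and put $B=x+y=\begin{bmatrix}0&1\\1&0\end{bmatrix}$, $C=x-y=\begin{bmatrix}0&1\\-1&0\end{bmatrix}$. Let $c=(h+1)^2+4yx\in U(\mathfrak{sl}_2(\mathbb{C}))$ be the Casimir element. For $\lambda\in\mathbb{C}$, let $I_\lambda$ be the two-sided ideal of $U(\mathfrak{sl}_2(\mathbb{C}))$ generated by the central element $c-(\lambda+1)^2$, and let $U(I_\lambda)=U(\mathfrak{sl}_2(\mathbb{C}))/I_\lambda$. $M_\lambda^C=U(I_\lambda)/U(I_\lambda)C$ is the quotient of the left regular module by the left ideal generated by the image of $C$. *)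

theory Defs
  imports
    "HOL-Analysis.Determinants"
    "HOL-Library.Poly_Mapping"
    "HOL-Algebra.Algebra"
    "HOL-Algebra.Algebraic_Closure_Type"
begin

section \<open>The Lie algebra \<open>sl\<^sub>2(\<complex>)\<close>\<close>

typedef sl2 = "{A :: complex^2^2. trace A = 0}"
  morphisms mat_of_sl2 sl2_of_mat
  by (rule exI[of _ 0]) (simp add: trace_def)

setup_lifting type_definition_sl2

instantiation sl2 :: ab_group_add
begin

lift_definition zero_sl2 :: sl2 is 0
  by (simp add: trace_def)

lift_definition plus_sl2 :: "sl2 \<Rightarrow> sl2 \<Rightarrow> sl2" is "\<lambda>A B. A + B"
  by (simp add: trace_add)

lift_definition minus_sl2 :: "sl2 \<Rightarrow> sl2 \<Rightarrow> sl2" is "\<lambda>A B. A - B"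
  by (simp add: trace_sub)

lift_definition uminus_sl2 :: "sl2 \<Rightarrow> sl2" is "\<lambda>A. - A"
  by (simp add: trace_def sum_negf)

instance
  by standard (transfer; simp)+

end

lift_definition sl2_scale :: "complex \<Rightarrow> sl2 \<Rightarrow> sl2" is "\<lambda>z A. \<chi> i j. z * A $ i $ j"
  by (simp add: trace_def sum_2 flip: distrib_left)

lift_definition sl2_bracket :: "sl2 \<Rightarrow> sl2 \<Rightarrow> sl2" is "\<lambda>A B. A ** B - B ** A"
  by (metis trace_sub trace_mul_sym right_minus_eq)

lift_definition sl2_x :: sl2 is "vector [vector [0, 1], vector [0, 0]]"
  by (simp add: trace_def sum_2)

lift_definition sl2_h :: sl2 is "vector [vector [1, 0], vector [0, -1]]"
  by (simp add: trace_def sum_2)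

lift_definition sl2_y :: sl2 is "vector [vector [0, 0], vector [1, 0]]"
  by (simp add: trace_def sum_2)

definition sl2_C :: sl2 where
  "sl2_C = sl2_x - sl2_y"


section \<open>The universal enveloping algebra\<close>

text \<open>
  The free monoid, written additively so that finitely supported functions on it with
  convolution (\<open>'a free_word \<Rightarrow>\<^sub>0 complex\<close>) form the free unital associative algebra.
\<close>

datatype 'a free_word = Word "'a list"

instantiation free_word :: (type) monoid_add
begin

definition zero_free_word :: "'a free_word" where
  "zero_free_word = Word []"

fun plus_free_word :: "'a free_word \<Rightarrow> 'a free_word \<Rightarrow> 'a free_word" where
  "plus_free_word (Word u) (Word v) = Word (u @ v)"

instance
proof
  fix a b c :: "'a free_word"
  show "a + b + c = a + (b + c)"
    by (cases a; cases b; cases c) simp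
  show "0 + a = a" "a + 0 = a"
    by (cases a; simp add: zero_free_word_def)+
qed

end

type_synonym free_sl2 = "sl2 free_word \<Rightarrow>\<^sub>0 complex"

definition free_gen :: "sl2 \<Rightarrow> free_sl2" where
  "free_gen a = Poly_Mapping.single (Word [a]) 1"

definition free_scalar :: "complex \<Rightarrow> free_sl2" where
  "free_scalar z = Poly_Mapping.single 0 z"

abbreviation free_ring :: "free_sl2 ring" where
  "free_ring \<equiv> ring_of_type_algebra"

text \<open>
  The free algebra is taken on the underlying set of \<open>sl\<^sub>2(\<complex>)\<close>. Imposing the first two families
  of relations gives the tensor algebra of the vector space \<open>sl\<^sub>2(\<complex>)\<close>; the third family then
  gives the enveloping algebra.
\<close>

definition U_relations :: "free_sl2 set" where
  "U_relations =
     {free_gen (a + b) - (free_gen a + free_gen b) |a b. True} \<union>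
     {free_gen (sl2_scale z a) - free_scalar z * free_gen a |z a. True} \<union>
     {free_gen a * free_gen b - free_gen b * free_gen a - free_gen (sl2_bracket a b) |a b. True}"

definition U_ideal :: "free_sl2 set" where
  "U_ideal = Idl\<^bsub>free_ring\<^esub> U_relations"

definition U_sl2 :: "free_sl2 set ring" where
  "U_sl2 = free_ring Quot U_ideal"

definition U_gen :: "sl2 \<Rightarrow> free_sl2 set" where
  "U_gen a = U_ideal +>\<^bsub>free_ring\<^esub> free_gen a"

definition U_scalar :: "complex \<Rightarrow> free_sl2 set" where
  "U_scalar z = U_ideal +>\<^bsub>free_ring\<^esub> free_scalar z"

definition casimir :: "free_sl2 set" where
  "casimir =
     (U_gen sl2_h \<oplus>\<^bsub>U_sl2\<^esub> \<one>\<^bsub>U_sl2\<^esub>) [^]\<^bsub>U_sl2\<^esub> (2::nat)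
     \<oplus>\<^bsub>U_sl2\<^esub> U_scalar 4 \<otimes>\<^bsub>U_sl2\<^esub> (U_gen sl2_y \<otimes>\<^bsub>U_sl2\<^esub> U_gen sl2_x)"

definition I_lam :: "complex \<Rightarrow> free_sl2 set set" where
  "I_lam l = Idl\<^bsub>U_sl2\<^esub> {casimir \<ominus>\<^bsub>U_sl2\<^esub> U_scalar ((l + 1)\<^sup>2)}"

definition U_lam :: "complex \<Rightarrow> free_sl2 set set ring" where
  "U_lam l = U_sl2 Quot I_lam l"

definition U_lam_proj :: "complex \<Rightarrow> free_sl2 set \<Rightarrow> free_sl2 set set" where
  "U_lam_proj l u = I_lam l +>\<^bsub>U_sl2\<^esub> u"


section \<open>Modules over \<open>sl\<^sub>2(\<complex>)\<close>\<close>

abbreviation complex_ring :: "complex ring" where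
  "complex_ring \<equiv> ring_of_type_algebra"

text \<open>
  As for every HOL-Algebra \<open>module\<close> record, the fields \<open>mult\<close> and \<open>one\<close> carry no meaning.
\<close>

record 'v sl2_module = "(complex, 'v) module" +
  act :: "sl2 \<Rightarrow> 'v \<Rightarrow> 'v"

locale sl2_module = Module.module complex_ring V
  for V :: "('v, 'm) sl2_module_scheme" (structure) +
  assumes act_closed: "v \<in> carrier V \<Longrightarrow> act V a v \<in> carrier V"
    and act_add: "\<lbrakk>v \<in> carrier V; w \<in> carrier V\<rbrakk> \<Longrightarrow>
      act V a (v \<oplus> w) = act V a v \<oplus> act V a w"
    and act_smult: "v \<in> carrier V \<Longrightarrow> act V a (z \<odot>\<^bsub>V\<^esub> v) = z \<odot>\<^bsub>V\<^esub> act V a v"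
    and add_act: "v \<in> carrier V \<Longrightarrow> act V (a + b) v = act V a v \<oplus> act V b v"
    and scale_act: "v \<in> carrier V \<Longrightarrow> act V (sl2_scale z a) v = z \<odot>\<^bsub>V\<^esub> act V a v"
    and bracket_act: "v \<in> carrier V \<Longrightarrow>
      act V (sl2_bracket a b) v = act V a (act V b v) \<ominus> act V b (act V a v)"

definition sl2_submodule :: "'v set \<Rightarrow> ('v, 'm) sl2_module_scheme \<Rightarrow> bool" where
  "sl2_submodule W V \<longleftrightarrow>
     submodule W complex_ring V \<and> (\<forall>a. \<forall>w\<in>W. act V a w \<in> W)"

definition simple_sl2_module :: "('v, 'm) sl2_module_scheme \<Rightarrow> bool" where
  "simple_sl2_module V \<longleftrightarrow>
     sl2_module V \<and> carrier V \<noteq> {\<zero>\<^bsub>V\<^esub>} \<and>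
     (\<forall>W. sl2_submodule W V \<longrightarrow> W = {\<zero>\<^bsub>V\<^esub>} \<or> W = carrier V)"

text \<open>
  The quotient of the left regular module of a ring \<open>R\<close> by a left ideal \<open>L\<close>; the action of \<open>r\<close>
  sends \<open>L + v\<close> to \<open>L + r v\<close>, in the style of \<^const>\<open>rcoset_mult\<close>.
\<close>

definition left_quotient :: "'r ring \<Rightarrow> 'r set \<Rightarrow> ('r, 'r set) module" where
  "left_quotient R L =
     \<lparr>carrier = a_rcosets\<^bsub>R\<^esub> L, monoid.mult = undefined, one = undefined, ring.zero = L, add = set_add R,
      module.smult = (\<lambda>r m. \<Union>v\<in>m. L +>\<^bsub>R\<^esub> (r \<otimes>\<^bsub>R\<^esub> v))\<rparr>"

text \<open>The \<open>sl\<^sub>2(\<complex>)\<close>-module underlying a module over \<^term>\<open>U_lam l\<close>.\<close>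

definition sl2_restrict ::
    "complex \<Rightarrow> (free_sl2 set set, 'v) module \<Rightarrow> 'v sl2_module" where
  "sl2_restrict l N =
     \<lparr>carrier = carrier N, monoid.mult = monoid.mult N, one = monoid.one N, ring.zero = ring.zero N, add = add N,
      module.smult = (\<lambda>z v. U_lam_proj l (U_scalar z) \<odot>\<^bsub>N\<^esub> v),
      act = (\<lambda>a v. U_lam_proj l (U_gen a) \<odot>\<^bsub>N\<^esub> v)\<rparr>"

text \<open>
  For a ring \<open>R\<close> that need not be commutative, \<open>PIdl\<^bsub>R\<^esub> a\<close> is the left ideal \<open>R a\<close>.
\<close>

definition M_C :: "complex \<Rightarrow> free_sl2 set set set sl2_module" where
  "M_C l =
     sl2_restrict l
       (left_quotient (U_lam l) (PIdl\<^bsub>U_lam l\<^esub> (U_lam_proj l (U_gen sl2_C))))"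

end

theory Submission
  imports Defs
begin

text \<open>
  Put \<open>P = h + \<i> (x + y)\<close> and \<open>Q = h - \<i> (x + y)\<close>. Then \<open>[C, P] = 2 \<i> P\<close> and \<open>[C, Q] = - 2 \<i> Q\<close>, so
  the module is spanned by \<open>C\<close>-eigenvectors \<open>v\<^sub>k\<close>, the classes of \<open>P^k\<close> for \<open>k \<ge> 0\<close> and of \<open>Q^(- k)\<close>
  for \<open>k \<le> 0\<close>, with distinct eigenvalues \<open>2 \<i> k\<close>. Hence every nonzero submodule contains some
  \<open>v\<^sub>k\<close>. Since \<open>Q P = c + (C + \<i>)\<^sup>2\<close> and \<open>P Q = c + (C - \<i>)\<^sup>2\<close>, these products act on \<open>v\<^sub>k\<close> by
  \<open>(\<lambda> + 1)\<^sup>2 - (2 k \<plusminus> 1)\<^sup>2\<close>, which is nonzero when \<open>\<lambda>\<close> is not an even integer; so one can move from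
  \<open>v\<^sub>k\<close> to the generator \<open>v\<^sub>0\<close>. The module is nonzero because the same formulas define an action
  of \<open>U(I\<^sub>\<lambda>)\<close> on the functions \<open>\<int> \<rightarrow> \<complex>\<close>, in which \<open>C\<close> kills the delta function at \<open>0\<close>.
\<close>

section \<open>The free algebra on \<open>sl\<^sub>2(\<complex>)\<close>\<close>

lemma free_scalar_mult: "free_scalar (a * b) = free_scalar a * free_scalar b"
  by (simp add: free_scalar_def mult_single)

lemma free_scalar_add: "free_scalar (a + b) = free_scalar a + free_scalar b"
  by (simp add: free_scalar_def single_add)

lemma free_scalar_uminus: "free_scalar (- a) = - free_scalar a"
  by (simp add: free_scalar_def single_uminus)

lemma free_scalar_diff: "free_scalar (a - b) = free_scalar a - free_scalar b"
  by (simp add: free_scalar_def single_diff)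

lemma free_scalar_0 [simp]: "free_scalar 0 = 0"
  by (simp add: free_scalar_def)

lemma free_scalar_1 [simp]: "free_scalar 1 = 1"
  by (simp add: free_scalar_def)

lemma free_scalar_numeral [simp]: "free_scalar (numeral n) = numeral n"
  by (simp add: free_scalar_def single_numeral)

lemma poly_mapping_single_induct [case_names zero add]:
  assumes "P 0" and "\<And>f k c. P f \<Longrightarrow> P (Poly_Mapping.single k c + f)"
  shows "P (f :: 'a \<Rightarrow>\<^sub>0 'b :: comm_monoid_add)"
proof (induction f rule: update_induct)
  case const
  then show ?case by (rule assms(1))
next
  case (update f a b)
  have "Poly_Mapping.update a b f = Poly_Mapping.single a b + f"
    using update by (intro poly_mapping_eqI)
      (auto simp: lookup_update lookup_add lookup_single when_def in_keys_iff)
  then show ?case using assms(2) update by simp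
qed

text \<open>Words are built by prepending letters, so only left multiplication by generators has to
  be checked. In this form an action of the Lie algebra yields closure under the whole free
  algebra.\<close>

lemma free_sl2_induct [case_names scalar add gen]:
  assumes scalar: "\<And>z. P (free_scalar z)"
    and add: "\<And>f g. P f \<Longrightarrow> P g \<Longrightarrow> P (f + g)"
    and gen: "\<And>a f. P f \<Longrightarrow> P (free_gen a * f)"
  shows "P f"
proof -
  have "P (Poly_Mapping.single (Word w) c)" for w c
  proof (induction w)
    case Nil
    then show ?case using scalar[of c] by (simp add: free_scalar_def zero_free_word_def)
  next
    case (Cons a w)
    have "Poly_Mapping.single (Word (a # w)) c = free_gen a * Poly_Mapping.single (Word w) c"
      by (simp add: free_gen_def mult_single)
    then show ?case using gen Cons by simp
  qed
  then have single: "P (Poly_Mapping.single k c)" for k c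
    by (cases k) auto
  show ?thesis
  proof (induction f rule: poly_mapping_single_induct)
    case zero
    then show ?case using scalar[of 0] by simp
  next
    case (add f k c)
    then show ?case using single assms(2) by blast
  qed
qed

lemma free_scalar_commute: "f * free_scalar z = free_scalar z * f"
proof (induction f rule: poly_mapping_single_induct)
  case (add f k c)
  then show ?case
    by (simp add: distrib_left distrib_right) (simp add: free_scalar_def mult_single mult.commute)
qed simp

text \<open>Stated on the ring type, since the free algebra is a type and the locale
  \<open>ideal\<close> is two-sided.\<close>

definition left_ideal :: "'a::ring_1 set \<Rightarrow> bool" where
  "left_ideal K \<longleftrightarrow> 0 \<in> K \<and> (\<forall>x\<in>K. \<forall>y\<in>K. x + y \<in> K) \<and> (\<forall>a. \<forall>x\<in>K. a * x \<in> K)"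

lemma left_idealI:
  assumes "0 \<in> K" "\<And>x y. x \<in> K \<Longrightarrow> y \<in> K \<Longrightarrow> x + y \<in> K" "\<And>a x. x \<in> K \<Longrightarrow> a * x \<in> K"
  shows "left_ideal K"
  using assms by (simp add: left_ideal_def)

lemma left_ideal_zero: "left_ideal K \<Longrightarrow> 0 \<in> K"
  and left_ideal_add: "left_ideal K \<Longrightarrow> x \<in> K \<Longrightarrow> y \<in> K \<Longrightarrow> x + y \<in> K"
  and left_ideal_mult: "left_ideal K \<Longrightarrow> x \<in> K \<Longrightarrow> a * x \<in> K"
  by (simp_all add: left_ideal_def)

lemma left_ideal_uminus: "left_ideal K \<Longrightarrow> x \<in> K \<Longrightarrow> - x \<in> K"
  using left_ideal_mult[of K x "-1"] by simp

lemma left_ideal_diff: "left_ideal K \<Longrightarrow> x \<in> K \<Longrightarrow> y \<in> K \<Longrightarrow> x - y \<in> K"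
  using left_ideal_add[of K x "- y"] left_ideal_uminus[of K y] by simp

section \<open>Coordinates on sl2 with respect to h, x, y and to C, P, Q\<close>

lemma sl2_eqI:
  assumes "mat_of_sl2 a $ 1 $ 1 = mat_of_sl2 b $ 1 $ 1"
    "mat_of_sl2 a $ 1 $ 2 = mat_of_sl2 b $ 1 $ 2"
    "mat_of_sl2 a $ 2 $ 1 = mat_of_sl2 b $ 2 $ 1"
  shows "a = b"
proof -
  have "mat_of_sl2 c $ 1 $ 1 + mat_of_sl2 c $ 2 $ 2 = 0" for c
    using mat_of_sl2[of c] by (simp add: trace_def sum_2)
  then have "mat_of_sl2 a $ 2 $ 2 = mat_of_sl2 b $ 2 $ 2"
    using assms(1) by (metis add_left_cancel)
  then have "mat_of_sl2 a = mat_of_sl2 b"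
    using assms by (simp add: vec_eq_iff forall_2)
  then show ?thesis
    by (simp add: mat_of_sl2_inject)
qed

lemma mat_of_sl2_22: "mat_of_sl2 a $ 2 $ 2 = - mat_of_sl2 a $ 1 $ 1"
  using mat_of_sl2[of a] by (simp add: trace_def sum_2 add_eq_0_iff)

lemmas mat_of_sl2_simps =
  plus_sl2.rep_eq minus_sl2.rep_eq uminus_sl2.rep_eq sl2_scale.rep_eq sl2_bracket.rep_eq
  sl2_x.rep_eq sl2_y.rep_eq sl2_h.rep_eq matrix_matrix_mult_def sum_2

lemma sl2_bracket_xy: "sl2_bracket sl2_x sl2_y = sl2_h"
  and sl2_bracket_hx: "sl2_bracket sl2_h sl2_x = sl2_scale 2 sl2_x"
  and sl2_bracket_hy: "sl2_bracket sl2_h sl2_y = sl2_scale (- 2) sl2_y"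
  and sl2_C_eq: "sl2_C = sl2_x + sl2_scale (- 1) sl2_y"
  by (rule sl2_eqI; simp add: mat_of_sl2_simps sl2_C_def)+

lemma sl2_decompose:
  "a = sl2_scale (mat_of_sl2 a $ 1 $ 1) sl2_h + (sl2_scale (mat_of_sl2 a $ 1 $ 2) sl2_x
     + sl2_scale (mat_of_sl2 a $ 2 $ 1) sl2_y)"
  by (rule sl2_eqI; simp add: mat_of_sl2_simps)

text \<open>\<open>coeff_C\<close>, \<open>coeff_P\<close> and \<open>coeff_Q\<close> are the
  coordinates in the basis C = x - y, P = h + i (x + y), Q = h - i (x + y).\<close>

definition coeff_C :: "sl2 \<Rightarrow> complex" where
  "coeff_C a = (mat_of_sl2 a $ 1 $ 2 - mat_of_sl2 a $ 2 $ 1) / 2"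

definition coeff_P :: "sl2 \<Rightarrow> complex" where
  "coeff_P a = mat_of_sl2 a $ 1 $ 1 / 2 - \<i> * (mat_of_sl2 a $ 1 $ 2 + mat_of_sl2 a $ 2 $ 1) / 4"

definition coeff_Q :: "sl2 \<Rightarrow> complex" where
  "coeff_Q a = mat_of_sl2 a $ 1 $ 1 / 2 + \<i> * (mat_of_sl2 a $ 1 $ 2 + mat_of_sl2 a $ 2 $ 1) / 4"

lemmas coeff_defs = coeff_C_def coeff_P_def coeff_Q_def

lemma coeff_add:
  "coeff_C (a + b) = coeff_C a + coeff_C b"
  "coeff_P (a + b) = coeff_P a + coeff_P b"
  "coeff_Q (a + b) = coeff_Q a + coeff_Q b"
  by (simp_all add: coeff_defs mat_of_sl2_simps field_simps)

lemma coeff_scale: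
  "coeff_C (sl2_scale z a) = z * coeff_C a"
  "coeff_P (sl2_scale z a) = z * coeff_P a"
  "coeff_Q (sl2_scale z a) = z * coeff_Q a"
  by (simp_all add: coeff_defs mat_of_sl2_simps field_simps)

text \<open>These are the brackets [C, P] = 2 i P, [C, Q] = - 2 i Q and [P, Q] = - 4 i C in
  coordinates.\<close>

lemma coeff_bracket:
  "coeff_C (sl2_bracket a b) = 4 * \<i> * (coeff_Q a * coeff_P b - coeff_P a * coeff_Q b)"
  "coeff_P (sl2_bracket a b) = 2 * \<i> * (coeff_C a * coeff_P b - coeff_P a * coeff_C b)"
  "coeff_Q (sl2_bracket a b) = 2 * \<i> * (coeff_Q a * coeff_C b - coeff_C a * coeff_Q b)"
  by (simp_all add: coeff_defs mat_of_sl2_simps mat_of_sl2_22 field_simps)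

section \<open>Ring identities for C, P, Q with an abstract square root \<open>j\<close> of
  -1\<close>

context
  fixes x y h j :: "'a::ring_1"
  assumes j: "j * j = - 1" and commute: "x * j = j * x" "y * j = j * y" "h * j = j * h"
begin

lemma j_simps:
  "j * (j * z) = - z" "x * (j * z) = j * (x * z)" "y * (j * z) = j * (y * z)"
  "h * (j * z) = j * (h * z)"
  by (simp_all add: j commute flip: mult.assoc)

text \<open>The identity holds before any bracket relation is imposed: the right side is a
  combination of the three defects that vanish in U(sl2). The next three identities have the same
  shape.\<close>

lemma sl2_CP:
  "(x - y) * (h + j * (x + y)) - (h + j * (x + y)) * (x - y) - 2 * j * (h + j * (x + y)) =
    (h * y - y * h + 2 * y) - (h * x - x * h - 2 * x) + 2 * j * (x * y - y * x - h)"
  by (simp add: algebra_simps j commute j_simps mult_2 mult_2_right)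

lemma sl2_CQ:
  "(x - y) * (h - j * (x + y)) - (h - j * (x + y)) * (x - y) + 2 * j * (h - j * (x + y)) =
    (h * y - y * h + 2 * y) - (h * x - x * h - 2 * x) - 2 * j * (x * y - y * x - h)"
  by (simp add: algebra_simps j commute j_simps mult_2 mult_2_right)

lemma sl2_QP:
  "(h - j * (x + y)) * (h + j * (x + y)) - (x - y + j)\<^sup>2 - ((h + 1)\<^sup>2 + 4 * (y * x)) =
    2 * (x * y - y * x - h) + j * ((h * x - x * h - 2 * x) + (h * y - y * h + 2 * y))"
proof -
  \<comment> \<open>Only \<open>2 * z\<close> is unfolded by \<open>mult_2\<close>, so the
    coefficient 4 is split first.\<close>
  have "4 * (y * x) = 2 * (y * x) + 2 * (y * x)" by (simp flip: distrib_right)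
  then show ?thesis
    by (simp only: power2_eq_square) (simp add: algebra_simps j commute j_simps mult_2 mult_2_right)
qed

lemma sl2_PQ:
  "(h + j * (x + y)) * (h - j * (x + y)) - (x - y - j)\<^sup>2 - ((h + 1)\<^sup>2 + 4 * (y * x)) =
    2 * (x * y - y * x - h) - j * ((h * x - x * h - 2 * x) + (h * y - y * h + 2 * y))"
proof -
  have "4 * (y * x) = 2 * (y * x) + 2 * (y * x)" by (simp flip: distrib_right)
  then show ?thesis
    by (simp only: power2_eq_square) (simp add: algebra_simps j commute j_simps mult_2 mult_2_right)
qed

end

definition free_casimir :: free_sl2 where
  "free_casimir = (free_gen sl2_h + 1)\<^sup>2 + 4 * (free_gen sl2_y * free_gen sl2_x)"

text \<open>For a left ideal \<open>K\<close> of a ring A this is the annihilator of the module A /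
  K. A relation in it holds as an identity of operators on the whole quotient, not only at the class
  of 1.\<close>

definition annihilator :: "'a::ring_1 set \<Rightarrow> 'a set" where
  "annihilator K = {f. \<forall>u. f * u \<in> K}"

lemma annihilatorD: "f \<in> annihilator K \<Longrightarrow> f * u \<in> K"
  by (simp add: annihilator_def)

lemma left_ideal_annihilator: "left_ideal K \<Longrightarrow> left_ideal (annihilator K)"
  by (auto simp: left_ideal_def annihilator_def distrib_right mult.assoc)

lemma free_gen_relations:
  assumes "U_relations \<subseteq> J"
  shows "free_gen (a + b) - (free_gen a + free_gen b) \<in> J"
    and "free_gen (sl2_scale z a) - free_scalar z * free_gen a \<in> J"
    and "free_gen a * free_gen b - free_gen b * free_gen a - free_gen (sl2_bracket a b) \<in> J"
  using assms unfolding U_relations_def by blast+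

text \<open>Two additivity defects and three homogeneity defects for \<open>sl2_decompose\<close>
  telescope to the claim, and each is a relation.\<close>

lemma free_gen_decompose:
  assumes J: "left_ideal J" and rel: "U_relations \<subseteq> J"
  shows "free_gen a - (free_scalar (mat_of_sl2 a $ 1 $ 1) * free_gen sl2_h
    + (free_scalar (mat_of_sl2 a $ 1 $ 2) * free_gen sl2_x
     + free_scalar (mat_of_sl2 a $ 2 $ 1) * free_gen sl2_y)) \<in> J"
proof -
  let ?h = "sl2_scale (mat_of_sl2 a $ 1 $ 1) sl2_h"
  let ?x = "sl2_scale (mat_of_sl2 a $ 1 $ 2) sl2_x"
  let ?y = "sl2_scale (mat_of_sl2 a $ 2 $ 1) sl2_y"
  note r = free_gen_relations[OF rel]
  have "(free_gen (?h + (?x + ?y)) - (free_gen ?h + free_gen (?x + ?y)))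
      + (free_gen (?x + ?y) - (free_gen ?x + free_gen ?y))
      + (free_gen ?h - free_scalar (mat_of_sl2 a $ 1 $ 1) * free_gen sl2_h)
      + (free_gen ?x - free_scalar (mat_of_sl2 a $ 1 $ 2) * free_gen sl2_x)
      + (free_gen ?y - free_scalar (mat_of_sl2 a $ 2 $ 1) * free_gen sl2_y) \<in> J"
    by (intro left_ideal_add[OF J] r)
  then show ?thesis
    by (simp add: sl2_decompose[symmetric] algebra_simps)
qed

lemma free_gen_C:
  assumes J: "left_ideal J" and rel: "U_relations \<subseteq> J"
  shows "free_gen sl2_C - (free_gen sl2_x - free_gen sl2_y) \<in> J"
proof -
  note r = free_gen_relations[OF rel]
  have "(free_gen (sl2_x + sl2_scale (- 1) sl2_y)
        - (free_gen sl2_x + free_gen (sl2_scale (- 1) sl2_y)))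
      + (free_gen (sl2_scale (- 1) sl2_y) - free_scalar (- 1) * free_gen sl2_y) \<in> J"
    by (intro left_ideal_add[OF J] r)
  then show ?thesis
    by (simp add: sl2_C_eq free_scalar_uminus algebra_simps)
qed

lemma free_gen_brackets:
  assumes J: "left_ideal J" and rel: "U_relations \<subseteq> J"
  shows "free_gen sl2_x * free_gen sl2_y - free_gen sl2_y * free_gen sl2_x - free_gen sl2_h \<in> J"
    and "free_gen sl2_h * free_gen sl2_x - free_gen sl2_x * free_gen sl2_h - 2 * free_gen sl2_x \<in> J"
    and "free_gen sl2_h * free_gen sl2_y - free_gen sl2_y * free_gen sl2_h + 2 * free_gen sl2_y \<in> J"
proof -
  note r = free_gen_relations[OF rel]
  show "free_gen sl2_x * free_gen sl2_y - free_gen sl2_y * free_gen sl2_x - free_gen sl2_h \<in> J"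
    using r(3)[of sl2_x sl2_y] by (simp add: sl2_bracket_xy)
  show "free_gen sl2_h * free_gen sl2_x - free_gen sl2_x * free_gen sl2_h - 2 * free_gen sl2_x \<in> J"
    using left_ideal_add[OF J r(3)[of sl2_h sl2_x] r(2)[of 2 sl2_x]]
    by (simp add: sl2_bracket_hx)
  show "free_gen sl2_h * free_gen sl2_y - free_gen sl2_y * free_gen sl2_h + 2 * free_gen sl2_y \<in> J"
    using left_ideal_add[OF J r(3)[of sl2_h sl2_y] r(2)[of "-2" sl2_y]]
    by (simp add: sl2_bracket_hy free_scalar_uminus)
qed

text \<open>This differs from \<open>free_gen sl2_C\<close> in the free algebra, where generators
  are not additive in the matrix; \<open>free_gen_C\<close> says that the two agree modulo the
  relations.\<close>

definition C_elt :: free_sl2 where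
  "C_elt = free_gen sl2_x - free_gen sl2_y"

definition P_elt :: free_sl2 where
  "P_elt = free_gen sl2_h + free_scalar \<i> * (free_gen sl2_x + free_gen sl2_y)"

definition Q_elt :: free_sl2 where
  "Q_elt = free_gen sl2_h - free_scalar \<i> * (free_gen sl2_x + free_gen sl2_y)"

lemma free_scalar_i: "free_scalar \<i> * free_scalar \<i> = - 1"
  by (simp add: free_scalar_uminus flip: free_scalar_mult)

text \<open>The exact identities \<open>sl2_CP\<close> to \<open>sl2_PQ\<close> turn the four
  expressions into combinations of the bracket relations.\<close>

lemma weight_vector_relations:
  assumes J: "left_ideal J" and rel: "U_relations \<subseteq> J"
  shows "C_elt * P_elt - P_elt * C_elt - free_scalar (2 * \<i>) * P_elt \<in> J"
    and "C_elt * Q_elt - Q_elt * C_elt + free_scalar (2 * \<i>) * Q_elt \<in> J"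
    and "Q_elt * P_elt - (C_elt + free_scalar \<i>)\<^sup>2 - free_casimir \<in> J"
    and "P_elt * Q_elt - (C_elt - free_scalar \<i>)\<^sup>2 - free_casimir \<in> J"
  unfolding C_elt_def P_elt_def Q_elt_def free_casimir_def free_scalar_mult free_scalar_numeral
    sl2_CP[OF free_scalar_i free_scalar_commute free_scalar_commute free_scalar_commute]
    sl2_CQ[OF free_scalar_i free_scalar_commute free_scalar_commute free_scalar_commute]
    sl2_QP[OF free_scalar_i free_scalar_commute free_scalar_commute free_scalar_commute]
    sl2_PQ[OF free_scalar_i free_scalar_commute free_scalar_commute free_scalar_commute]
  by (intro left_ideal_add[OF J] left_ideal_diff[OF J] left_ideal_mult[OF J]
      free_gen_brackets[OF J rel])+

text \<open>Reduces the action of an arbitrary generator to those of C, P and Q.\<close>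

lemma free_gen_CPQ:
  assumes J: "left_ideal J" and rel: "U_relations \<subseteq> J"
  shows "free_gen a - (free_scalar (coeff_C a) * C_elt + free_scalar (coeff_P a) * P_elt
    + free_scalar (coeff_Q a) * Q_elt) \<in> J"
proof -
  have coords: "coeff_P a + coeff_Q a = mat_of_sl2 a $ 1 $ 1"
    "coeff_C a + (coeff_P a * \<i> - coeff_Q a * \<i>) = mat_of_sl2 a $ 1 $ 2"
    "(coeff_P a * \<i> - coeff_Q a * \<i>) - coeff_C a = mat_of_sl2 a $ 2 $ 1"
    by (simp_all add: coeff_defs field_simps)
  have "free_scalar (coeff_C a) * C_elt + free_scalar (coeff_P a) * P_elt + free_scalar (coeff_Q a) * Q_elt =
     free_scalar (coeff_P a + coeff_Q a) * free_gen sl2_h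
     + (free_scalar (coeff_C a + (coeff_P a * \<i> - coeff_Q a * \<i>)) * free_gen sl2_x
     + free_scalar ((coeff_P a * \<i> - coeff_Q a * \<i>) - coeff_C a) * free_gen sl2_y)"
    by (simp only: C_elt_def P_elt_def Q_elt_def free_scalar_add free_scalar_diff free_scalar_mult)
      (simp add: algebra_simps)
  then show ?thesis
    using free_gen_decompose[OF J rel, of a] by (simp only: coords)
qed

section \<open>Maximality of the left ideal\<close>

definition weight_elt :: "int \<Rightarrow> free_sl2" where
  "weight_elt k = (if k \<ge> 0 then P_elt ^ nat k else Q_elt ^ nat (- k))"

lemma weight_elt_0 [simp]: "weight_elt 0 = 1"
  by (simp add: weight_elt_def)

text \<open>Steps away from index 0 are exact equalities. Steps towards 0 hold only modulo a left
  ideal and bring in the scalars of \<open>QP_weight_elt\<close> and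
  \<open>PQ_weight_elt\<close>.\<close>

lemma P_weight_elt: "k \<ge> 0 \<Longrightarrow> P_elt * weight_elt k = weight_elt (k + 1)"
  by (simp add: weight_elt_def nat_add_distrib)

lemma Q_weight_elt: "k \<le> 0 \<Longrightarrow> Q_elt * weight_elt k = weight_elt (k - 1)"
proof -
  assume k: "k \<le> 0"
  then have "nat (1 - k) = Suc (nat (- k))" by simp
  with k show ?thesis by (cases "k = 0") (simp_all add: weight_elt_def)
qed

text \<open>Such a \<open>K\<close> makes the quotient of the free algebra by \<open>K\<close> a
  U(sl2)-module generated by a vector killed by C, on which the Casimir element acts by
  \<open>\<mu>\<^sup>2\<close>.\<close>

locale spherical_left_ideal =
  fixes K :: "free_sl2 set" and \<mu> :: complex
  assumes left_ideal_K: "left_ideal K"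
    and relations_K: "U_relations \<subseteq> annihilator K"
    and casimir_K: "free_casimir - free_scalar (\<mu>\<^sup>2) \<in> annihilator K"
    and C_K: "free_gen sl2_C \<in> K"
begin

lemmas K_add = left_ideal_add[OF left_ideal_K]
  and K_diff = left_ideal_diff[OF left_ideal_K]
  and K_mult = left_ideal_mult[OF left_ideal_K]
  and K_zero = left_ideal_zero[OF left_ideal_K]
  and J_add = left_ideal_add[OF left_ideal_annihilator[OF left_ideal_K]]
  and J_relations = weight_vector_relations[OF left_ideal_annihilator[OF left_ideal_K] relations_K]

definition congr_K :: "free_sl2 \<Rightarrow> free_sl2 \<Rightarrow> bool" (infix \<open>\<doteq>\<close> 50) where
  "f \<doteq> g \<longleftrightarrow> f - g \<in> K"

lemma congr_refl [simp]: "f \<doteq> f"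
  by (simp add: congr_K_def K_zero)

lemma congr_trans [trans]: "f \<doteq> g \<Longrightarrow> g \<doteq> h \<Longrightarrow> f \<doteq> h"
  using K_add[of "f - g" "g - h"] by (simp add: congr_K_def)

lemma congr_add: "f \<doteq> f' \<Longrightarrow> g \<doteq> g' \<Longrightarrow> f + g \<doteq> f' + g'"
  using K_add[of "f - f'" "g - g'"] by (simp add: congr_K_def add_diff_add)

lemma congr_diff: "f \<doteq> f' \<Longrightarrow> g \<doteq> g' \<Longrightarrow> f - g \<doteq> f' - g'"
  using K_diff[of "f - f'" "g - g'"] by (simp add: congr_K_def algebra_simps)

lemma congr_mult: "f \<doteq> g \<Longrightarrow> u * f \<doteq> u * g"
  using K_mult[of "f - g" u] by (simp add: congr_K_def right_diff_distrib)

text \<open>\<open>K\<close> is only a left ideal, so congruences cannot be multiplied on the right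
  in general; membership in the annihilator is what permits it.\<close>

lemma congr_annihilator: "f - g \<in> annihilator K \<Longrightarrow> f * u \<doteq> g * u"
  using annihilatorD[of "f - g" K u] by (simp add: congr_K_def left_diff_distrib)

lemma congr_sum: "(\<And>k. k \<in> S \<Longrightarrow> f k \<doteq> g k) \<Longrightarrow> sum f S \<doteq> sum g S"
  by (induction S rule: infinite_finite_induct) (auto intro: congr_add)

lemma CP_congr: "C_elt * (P_elt * u) \<doteq> P_elt * (C_elt * u) + free_scalar (2 * \<i>) * (P_elt * u)"
  using congr_annihilator[of "C_elt * P_elt" "P_elt * C_elt + free_scalar (2 * \<i>) * P_elt" u] J_relations(1)
  by (simp add: distrib_right mult.assoc diff_diff_eq)

lemma CQ_congr: "C_elt * (Q_elt * u) \<doteq> Q_elt * (C_elt * u) - free_scalar (2 * \<i>) * (Q_elt * u)"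
  using congr_annihilator[of "C_elt * Q_elt" "Q_elt * C_elt - free_scalar (2 * \<i>) * Q_elt" u] J_relations(2)
  by (simp add: left_diff_distrib mult.assoc diff_diff_eq2 add_diff_eq diff_add_eq)

lemma QP_congr: "Q_elt * (P_elt * u) \<doteq> (C_elt + free_scalar \<i>)\<^sup>2 * u + free_scalar (\<mu>\<^sup>2) * u"
  using congr_annihilator[of "Q_elt * P_elt" "(C_elt + free_scalar \<i>)\<^sup>2 + free_scalar (\<mu>\<^sup>2)" u]
    J_add[OF J_relations(3) casimir_K]
  by (simp add: distrib_right mult.assoc diff_diff_eq)

lemma PQ_congr: "P_elt * (Q_elt * u) \<doteq> (C_elt - free_scalar \<i>)\<^sup>2 * u + free_scalar (\<mu>\<^sup>2) * u"
  using congr_annihilator[of "P_elt * Q_elt" "(C_elt - free_scalar \<i>)\<^sup>2 + free_scalar (\<mu>\<^sup>2)" u]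
    J_add[OF J_relations(4) casimir_K]
  by (simp add: distrib_right mult.assoc diff_diff_eq)

lemma C_1: "C_elt \<doteq> 0"
proof -
  have "free_gen sl2_C - C_elt \<in> K"
    using annihilatorD[OF free_gen_C[OF left_ideal_annihilator[OF left_ideal_K] relations_K], of 1]
    by (simp add: C_elt_def)
  from K_diff[OF C_K this] show ?thesis by (simp add: congr_K_def)
qed

text \<open>By \<open>CP_congr\<close> each further factor P raises the eigenvalue of C by 2 i,
  starting from 0 by \<open>C_1\<close>.\<close>

lemma C_weight_P: "C_elt * P_elt ^ n \<doteq> free_scalar (2 * \<i> * of_nat n) * P_elt ^ n"
proof (induction n)
  case 0
  then show ?case using C_1 by simp
next
  case (Suc n)
  have "C_elt * P_elt ^ Suc n \<doteq> P_elt * (C_elt * P_elt ^ n) + free_scalar (2 * \<i>) * P_elt ^ Suc n"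
    using CP_congr by simp
  also have "\<dots> \<doteq> P_elt * (free_scalar (2 * \<i> * of_nat n) * P_elt ^ n) + free_scalar (2 * \<i>) * P_elt ^ Suc n"
    by (intro congr_add congr_mult Suc congr_refl)
  also have "\<dots> = free_scalar (2 * \<i> * of_nat (Suc n)) * P_elt ^ Suc n"
    using free_scalar_commute[of P_elt "2 * \<i> * of_nat n"]
    by (simp add: distrib_left distrib_right free_scalar_add flip: mult.assoc)
  finally show ?case .
qed

lemma C_weight_Q: "C_elt * Q_elt ^ n \<doteq> free_scalar (- (2 * \<i> * of_nat n)) * Q_elt ^ n"
proof (induction n)
  case 0
  then show ?case using C_1 by simp
next
  case (Suc n)
  have "C_elt * Q_elt ^ Suc n \<doteq> Q_elt * (C_elt * Q_elt ^ n) - free_scalar (2 * \<i>) * Q_elt ^ Suc n"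
    using CQ_congr by simp
  also have "\<dots> \<doteq> Q_elt * (free_scalar (- (2 * \<i> * of_nat n)) * Q_elt ^ n) - free_scalar (2 * \<i>) * Q_elt ^ Suc n"
    by (intro congr_diff congr_mult Suc congr_refl)
  also have "\<dots> = free_scalar (- (2 * \<i> * of_nat (Suc n))) * Q_elt ^ Suc n"
    using free_scalar_commute[of Q_elt "- (2 * \<i> * of_nat n)"]
    by (simp add: distrib_left distrib_right left_diff_distrib free_scalar_diff free_scalar_uminus
        flip: mult.assoc)
  finally show ?case .
qed

lemma C_weight_elt: "C_elt * weight_elt k \<doteq> free_scalar (2 * \<i> * of_int k) * weight_elt k"
proof (cases "k \<ge> 0")
  case True
  then show ?thesis using C_weight_P[of "nat k"] by (simp add: weight_elt_def)
next
  case False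
  then show ?thesis using C_weight_Q[of "nat (- k)"] by (simp add: weight_elt_def)
qed

lemma C_shift_square:
  "(C_elt + free_scalar z)\<^sup>2 * weight_elt k \<doteq> free_scalar ((2 * \<i> * of_int k + z)\<^sup>2) * weight_elt k"
proof -
  let ?w = "2 * \<i> * of_int k + z"
  have *: "(C_elt + free_scalar z) * weight_elt k \<doteq> free_scalar ?w * weight_elt k"
    using congr_add[OF C_weight_elt[of k] congr_refl[of "free_scalar z * weight_elt k"]]
    by (simp add: distrib_right free_scalar_add)
  have "(C_elt + free_scalar z)\<^sup>2 * weight_elt k \<doteq> (C_elt + free_scalar z) * (free_scalar ?w * weight_elt k)"
    using congr_mult[OF *] by (simp add: power2_eq_square mult.assoc)
  also have "\<dots> = free_scalar ?w * ((C_elt + free_scalar z) * weight_elt k)"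
    by (metis free_scalar_commute mult.assoc)
  also have "\<dots> \<doteq> free_scalar ?w * (free_scalar ?w * weight_elt k)"
    by (intro congr_mult *)
  finally show ?thesis
    by (simp add: power2_eq_square free_scalar_mult mult.assoc)
qed

text \<open>The eigenvalue 2 i k of C is put into QP = c + (C + i)^2, where (2 i k + i)^2 = - (2 k +
  1)^2.\<close>

lemma QP_weight_elt:
  "Q_elt * (P_elt * weight_elt k) \<doteq> free_scalar (\<mu>\<^sup>2 - (2 * of_int k + 1)\<^sup>2) * weight_elt k"
proof -
  have "Q_elt * (P_elt * weight_elt k) \<doteq> (C_elt + free_scalar \<i>)\<^sup>2 * weight_elt k + free_scalar (\<mu>\<^sup>2) * weight_elt k"
    by (rule QP_congr)
  also have "\<dots> \<doteq> free_scalar ((2 * \<i> * of_int k + \<i>)\<^sup>2) * weight_elt k + free_scalar (\<mu>\<^sup>2) * weight_elt k"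
    by (intro congr_add C_shift_square congr_refl)
  also have "\<dots> = free_scalar ((2 * \<i> * of_int k + \<i>)\<^sup>2 + \<mu>\<^sup>2) * weight_elt k"
    by (simp add: distrib_right free_scalar_add)
  also have "(2 * \<i> * of_int k + \<i>)\<^sup>2 + \<mu>\<^sup>2 = \<mu>\<^sup>2 - (2 * of_int k + 1)\<^sup>2"
    by (simp add: power2_eq_square algebra_simps)
  finally show ?thesis .
qed

lemma PQ_weight_elt:
  "P_elt * (Q_elt * weight_elt k) \<doteq> free_scalar (\<mu>\<^sup>2 - (2 * of_int k - 1)\<^sup>2) * weight_elt k"
proof -
  have "P_elt * (Q_elt * weight_elt k) \<doteq> (C_elt + free_scalar (- \<i>))\<^sup>2 * weight_elt k + free_scalar (\<mu>\<^sup>2) * weight_elt k"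
    using PQ_congr by (simp add: free_scalar_uminus)
  also have "\<dots> \<doteq> free_scalar ((2 * \<i> * of_int k + - \<i>)\<^sup>2) * weight_elt k + free_scalar (\<mu>\<^sup>2) * weight_elt k"
    by (intro congr_add C_shift_square congr_refl)
  also have "\<dots> = free_scalar ((2 * \<i> * of_int k + - \<i>)\<^sup>2 + \<mu>\<^sup>2) * weight_elt k"
    by (simp add: distrib_right free_scalar_add)
  also have "(2 * \<i> * of_int k + - \<i>)\<^sup>2 + \<mu>\<^sup>2 = \<mu>\<^sup>2 - (2 * of_int k - 1)\<^sup>2"
    by (simp add: power2_eq_square algebra_simps)
  finally show ?thesis .
qed

text \<open>For k >= 0 the scalar is 1. For k < 0 the element is Q times
  \<open>weight_elt (k + 1)\<close>, and \<open>PQ_weight_elt\<close> supplies the scalar, which may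
  be 0.\<close>

lemma P_weight_congr: "\<exists>c. P_elt * weight_elt k \<doteq> free_scalar c * weight_elt (k + 1)"
proof (cases "k \<ge> 0")
  case True
  then show ?thesis by (intro exI[of _ 1]) (simp add: P_weight_elt)
next
  case False
  then have "weight_elt k = Q_elt * weight_elt (k + 1)"
    using Q_weight_elt[of "k + 1"] by simp
  then show ?thesis using PQ_weight_elt by metis
qed

lemma Q_weight_congr: "\<exists>c. Q_elt * weight_elt k \<doteq> free_scalar c * weight_elt (k - 1)"
proof (cases "k \<le> 0")
  case True
  then show ?thesis by (intro exI[of _ 1]) (simp add: Q_weight_elt)
next
  case False
  then have "weight_elt k = P_elt * weight_elt (k - 1)"
    using P_weight_elt[of "k - 1"] by simp
  then show ?thesis using QP_weight_elt by metis
qed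

text \<open>The linear span of the weight elements, as formal sums in which indices may repeat;
  closure properties become direct inductions.\<close>

inductive_set weight_span :: "free_sl2 set" where
  zero: "0 \<in> weight_span"
| add: "f \<in> weight_span \<Longrightarrow> free_scalar c * weight_elt k + f \<in> weight_span"

lemma weight_span_add: "f \<in> weight_span \<Longrightarrow> g \<in> weight_span \<Longrightarrow> f + g \<in> weight_span"
  by (induction rule: weight_span.induct) (auto simp: add.assoc intro: weight_span.intros)

lemma weight_span_weight: "free_scalar c * weight_elt k \<in> weight_span"
  using weight_span.add[OF weight_span.zero, of c k] by simp

lemma weight_span_scalar: "f \<in> weight_span \<Longrightarrow> free_scalar z * f \<in> weight_span"
  by (induction rule: weight_span.induct)
    (auto simp: distrib_left mult.assoc[symmetric] free_scalar_mult[symmetric] intro: weight_span.intros)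

lemma weight_span_step:
  assumes "\<And>k. \<exists>c n. u * weight_elt k \<doteq> free_scalar c * weight_elt n" and "f \<in> weight_span"
  shows "\<exists>g\<in>weight_span. u * f \<doteq> g"
  using assms(2)
proof (induction rule: weight_span.induct)
  case zero
  then show ?case using weight_span.zero by (intro bexI[of _ 0]) auto
next
  case (add f c k)
  then obtain g where g: "g \<in> weight_span" "u * f \<doteq> g" by blast
  obtain d n where d: "u * weight_elt k \<doteq> free_scalar d * weight_elt n" using assms(1) by blast
  have "u * (free_scalar c * weight_elt k) = free_scalar c * (u * weight_elt k)"
    by (metis free_scalar_commute mult.assoc)
  also have "\<dots> \<doteq> free_scalar (c * d) * weight_elt n"
    using congr_mult[OF d] by (simp add: free_scalar_mult mult.assoc)
  finally show ?case using g
    by (intro bexI[of _ "free_scalar (c * d) * weight_elt n + g"])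
      (auto simp: distrib_left intro: weight_span.intros congr_add)
qed

lemma weight_span_CPQ:
  assumes "f \<in> weight_span"
  shows "\<exists>g\<in>weight_span. C_elt * f \<doteq> g" "\<exists>g\<in>weight_span. P_elt * f \<doteq> g" "\<exists>g\<in>weight_span. Q_elt * f \<doteq> g"
  by (rule weight_span_step[OF _ assms], use C_weight_elt P_weight_congr Q_weight_congr in blast)+

text \<open>Modulo \<open>K\<close> the span contains 1 and is stable under C, P and Q, hence under
  every generator.\<close>

lemma congr_weight_span: "\<exists>g\<in>weight_span. f \<doteq> g"
proof (induction f rule: free_sl2_induct)
  case (scalar z)
  then show ?case using weight_span_weight[of z 0] by force
next
  case (add f g)
  then show ?case by (meson congr_add weight_span_add)
next
  case (gen a f)
  then obtain g where g: "g \<in> weight_span" "f \<doteq> g" by blast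
  obtain c p q where *: "c \<in> weight_span" "p \<in> weight_span" "q \<in> weight_span"
    "C_elt * g \<doteq> c" "P_elt * g \<doteq> p" "Q_elt * g \<doteq> q"
    using weight_span_CPQ[OF g(1)] by blast
  have "free_gen a * f \<doteq> free_gen a * g"
    by (intro congr_mult g)
  also have "\<dots> \<doteq> (free_scalar (coeff_C a) * C_elt + free_scalar (coeff_P a) * P_elt + free_scalar (coeff_Q a) * Q_elt) * g"
    by (rule congr_annihilator[OF free_gen_CPQ[OF left_ideal_annihilator[OF left_ideal_K] relations_K]])
  also have "\<dots> = free_scalar (coeff_C a) * (C_elt * g) + free_scalar (coeff_P a) * (P_elt * g) + free_scalar (coeff_Q a) * (Q_elt * g)"
    by (simp add: distrib_right mult.assoc)
  also have "\<dots> \<doteq> free_scalar (coeff_C a) * c + free_scalar (coeff_P a) * p + free_scalar (coeff_Q a) * q"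
    by (intro congr_add congr_mult *)
  finally show ?case
    using * by (blast intro: weight_span_add weight_span_scalar)
qed

text \<open>Collects terms of equal index, because separating eigenvectors requires distinct
  eigenvalues.\<close>

lemma weight_span_sum:
  assumes "f \<in> weight_span"
  shows "\<exists>S c. finite S \<and> f = (\<Sum>k\<in>S. free_scalar (c k) * weight_elt k)"
  using assms
proof (induction rule: weight_span.induct)
  case zero
  then show ?case by (intro exI[of _ "{}"]) auto
next
  case (add f d n)
  then obtain S c where S: "finite S" "f = (\<Sum>k\<in>S. free_scalar (c k) * weight_elt k)" by blast
  show ?case
  proof (cases "n \<in> S")
    case True
    have "free_scalar d * weight_elt n + f =
      (\<Sum>k\<in>S. free_scalar ((c(n := d + c n)) k) * weight_elt k)"
      using S True by (simp add: sum.remove distrib_right free_scalar_add add.assoc)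
    then show ?thesis using S by blast
  next
    case False
    have "(\<Sum>k\<in>S. free_scalar ((c(n := d)) k) * weight_elt k) = f"
      unfolding S(2) using False by (intro sum.cong) auto
    then have "free_scalar d * weight_elt n + f =
      (\<Sum>k\<in>insert n S. free_scalar ((c(n := d)) k) * weight_elt k)"
      using S False by simp
    then show ?thesis using S by (meson finite_insert)
  qed
qed

end



section \<open>Left ideals above \<open>K\<close>, corresponding to submodules of the
  quotient\<close>

locale spherical_left_ideal_above = spherical_left_ideal +
  fixes W :: "free_sl2 set"
  assumes left_ideal_W: "left_ideal W" and K_subset_W: "K \<subseteq> W"
begin

lemma W_congr: "f \<in> W \<Longrightarrow> f \<doteq> g \<Longrightarrow> g \<in> W"
  using left_ideal_diff[OF left_ideal_W, of f "f - g"] K_subset_W by (auto simp: congr_K_def)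

lemma W_scalar: "free_scalar c * f \<in> W \<Longrightarrow> c \<noteq> 0 \<Longrightarrow> f \<in> W"
  using left_ideal_mult[OF left_ideal_W, of "free_scalar c * f" "free_scalar (inverse c)"]
  by (simp flip: mult.assoc free_scalar_mult)

text \<open>Weight elements of different index have different eigenvalues under C. The coefficients
  stay arbitrary in the induction because its hypothesis is applied to rescaled ones.\<close>

lemma W_weight_components:
  assumes "finite S" "(\<Sum>k\<in>S. free_scalar (c k) * weight_elt k) \<in> W" "k \<in> S"
  shows "free_scalar (c k) * weight_elt k \<in> W"
  using assms
proof (induction S arbitrary: c k rule: finite_induct)
  case (insert n S)
  let ?f = "\<Sum>k\<in>insert n S. free_scalar (c k) * weight_elt k"
  \<comment> \<open>multiplication by \<open>?u\<close> removes the component of index \<open>n\<close> and rescales the others\<close>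
  let ?u = "C_elt - free_scalar (2 * \<i> * of_int n)"
  have "?u * (free_scalar (c k) * weight_elt k) \<doteq> free_scalar (2 * \<i> * of_int (k - n) * c k) * weight_elt k" for k
  proof -
    have "?u * (free_scalar (c k) * weight_elt k) = free_scalar (c k) * (?u * weight_elt k)"
      by (metis free_scalar_commute mult.assoc)
    also have "\<dots> \<doteq> free_scalar (c k) * (free_scalar (2 * \<i> * of_int k) * weight_elt k - free_scalar (2 * \<i> * of_int n) * weight_elt k)"
      unfolding left_diff_distrib by (intro congr_mult congr_diff C_weight_elt congr_refl)
    also have "\<dots> = free_scalar (c k * (2 * \<i> * of_int k - 2 * \<i> * of_int n)) * weight_elt k"
      by (simp only: free_scalar_mult free_scalar_diff left_diff_distrib right_diff_distrib mult.assoc)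
    finally show ?thesis by (simp add: algebra_simps)
  qed
  then have "(\<Sum>k\<in>insert n S. ?u * (free_scalar (c k) * weight_elt k)) \<doteq>
      (\<Sum>k\<in>insert n S. free_scalar (2 * \<i> * of_int (k - n) * c k) * weight_elt k)"
    by (rule congr_sum)
  moreover have "?u * ?f \<in> W"
    by (rule left_ideal_mult[OF left_ideal_W insert.prems(1)])
  ultimately have "(\<Sum>k\<in>insert n S. free_scalar (2 * \<i> * of_int (k - n) * c k) * weight_elt k) \<in> W"
    using W_congr unfolding sum_distrib_left by blast
  then have "(\<Sum>k\<in>S. free_scalar (2 * \<i> * of_int (k - n) * c k) * weight_elt k) \<in> W"
    using insert.hyps by simp
  then have "free_scalar (2 * \<i> * of_int (k - n) * c k) * weight_elt k \<in> W" if "k \<in> S" for k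
    using insert.IH[of "\<lambda>k. 2 * \<i> * of_int (k - n) * c k"] that by simp
  \<comment> \<open>The factor 2 i (k - n) is nonzero, since \<open>n\<close> is not in
    \<open>S\<close>, and can be divided out.\<close>
  then have IH: "free_scalar (c k) * weight_elt k \<in> W" if "k \<in> S" for k
    using W_scalar[of "2 * \<i> * of_int (k - n)" "free_scalar (c k) * weight_elt k"] that insert.hyps
    by (auto simp: free_scalar_mult mult.assoc)
  then have "(\<Sum>k\<in>S. free_scalar (c k) * weight_elt k) \<in> W"
    by (induction S rule: infinite_finite_induct)
       (auto intro: left_ideal_zero[OF left_ideal_W] left_ideal_add[OF left_ideal_W])
  \<comment> \<open>Subtracting all other components leaves the one of index
    \<open>n\<close>.\<close>
  from left_ideal_diff[OF left_ideal_W insert.prems(1) this]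
  have "free_scalar (c n) * weight_elt n \<in> W"
    using insert.hyps by simp
  then show ?case using IH insert.prems by blast
qed simp

lemma W_weight_0:
  assumes "\<And>n :: int. \<mu> \<noteq> 2 * of_int n + 1" and "weight_elt k \<in> W"
  shows "1 \<in> W"
proof -
  \<comment> \<open>Otherwise \<open>\<mu>\<close> would be 2 n + 1 or - (2 n + 1) = 2 (- n - 1) +
    1.\<close>
  have nonzero: "\<mu>\<^sup>2 - (2 * of_int n + 1)\<^sup>2 \<noteq> 0" for n :: int
    using assms(1)[of n] assms(1)[of "- n - 1"] by (auto simp: power2_eq_iff)
  have "\<mu>\<^sup>2 - (2 * of_int n - 1)\<^sup>2 \<noteq> 0" for n :: int
    using nonzero[of "n - 1"] by (simp add: algebra_simps)
  note nonzero = nonzero this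
  \<comment> \<open>For n > 0 the element is P times its predecessor, so Q leads back to index n - 1
    up to a nonzero scalar.\<close>
  have down: "weight_elt (n - 1) \<in> W" if "n > 0" "weight_elt n \<in> W" for n
  proof -
    have "Q_elt * (P_elt * weight_elt (n - 1)) \<in> W"
      using that P_weight_elt[of "n - 1"] left_ideal_mult[OF left_ideal_W] by simp
    then show ?thesis using QP_weight_elt W_congr W_scalar nonzero by blast
  qed
  have up: "weight_elt (n + 1) \<in> W" if "n < 0" "weight_elt n \<in> W" for n
  proof -
    have "P_elt * (Q_elt * weight_elt (n + 1)) \<in> W"
      using that Q_weight_elt[of "n + 1"] left_ideal_mult[OF left_ideal_W] by simp
    then show ?thesis using PQ_weight_elt W_congr W_scalar nonzero by blast
  qed
  have "weight_elt (int m) \<in> W \<Longrightarrow> weight_elt 0 \<in> W" for m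
  proof (induction m)
    case (Suc m)
    then show ?case using down[of "int (Suc m)"] by simp
  qed simp
  moreover have "weight_elt (- int m) \<in> W \<Longrightarrow> weight_elt 0 \<in> W" for m
  proof (induction m)
    case (Suc m)
    then show ?case using up[of "- int (Suc m)"] by simp
  qed simp
  ultimately show ?thesis
    using assms(2) by (cases k rule: int_cases2) auto
qed

text \<open>An element of \<open>W\<close> outside \<open>K\<close> is congruent to a sum of weight
  elements with some nonzero coefficient; the corresponding weight element lies in \<open>W\<close>
  and leads to 1.\<close>

lemma maximal:
  assumes "\<And>n :: int. \<mu> \<noteq> 2 * of_int n + 1"
  shows "W = K \<or> W = UNIV"
proof (cases "W \<subseteq> K")
  case False
  then obtain w where w: "w \<in> W" "w \<notin> K" by blast
  obtain g where g: "g \<in> weight_span" "w \<doteq> g" using congr_weight_span by blast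
  then obtain S c where S: "finite S" "g = (\<Sum>k\<in>S. free_scalar (c k) * weight_elt k)"
    using weight_span_sum by blast
  have "g \<in> W" using w g W_congr by blast
  moreover have "g \<noteq> 0" using w g by (auto simp: congr_K_def)
  ultimately obtain k where k: "k \<in> S" "c k \<noteq> 0" using S
    by (metis (mono_tags, lifting) free_scalar_0 mult_zero_left sum.neutral)
  then have "weight_elt k \<in> W"
    using W_weight_components[of S c k] S \<open>g \<in> W\<close> W_scalar by blast
  then have "1 \<in> W" using W_weight_0 assms by blast
  then have "a \<in> W" for a using left_ideal_mult[OF left_ideal_W, of 1 a] by simp
  then show ?thesis by blast
qed (use K_subset_W in blast)

end

section \<open>An action on functions on the integers\<close>

fun word_action :: "(sl2 \<Rightarrow> 'v \<Rightarrow> 'v) \<Rightarrow> sl2 free_word \<Rightarrow> 'v \<Rightarrow> 'v" where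
  "word_action \<phi> (Word w) v = foldr \<phi> w v"

lemma word_action_add: "word_action \<phi> (u + w) v = word_action \<phi> u (word_action \<phi> w v)"
  by (cases u; cases w) simp

lemma word_action_0 [simp]: "word_action \<phi> 0 v = v"
  by (simp add: zero_free_word_def)

definition free_action ::
    "(sl2 \<Rightarrow> ('k \<Rightarrow> complex) \<Rightarrow> 'k \<Rightarrow> complex) \<Rightarrow> free_sl2 \<Rightarrow> ('k \<Rightarrow> complex) \<Rightarrow> 'k \<Rightarrow> complex" where
  "free_action \<phi> f v k =
    (\<Sum>w\<in>Poly_Mapping.keys f. Poly_Mapping.lookup f w * word_action \<phi> w v k)"

text \<open>Allows sums over different key sets to be compared on a common finite set.\<close>

lemma free_action_superset:
  assumes "finite S" "Poly_Mapping.keys f \<subseteq> S"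
  shows "free_action \<phi> f v k = (\<Sum>w\<in>S. Poly_Mapping.lookup f w * word_action \<phi> w v k)"
  unfolding free_action_def using assms
  by (intro sum.mono_neutral_left) (auto simp: in_keys_iff)

lemma free_action_0 [simp]: "free_action \<phi> 0 v = (\<lambda>k. 0)"
  by (simp add: free_action_def fun_eq_iff)

lemma free_action_add: "free_action \<phi> (f + g) v k = free_action \<phi> f v k + free_action \<phi> g v k"
proof -
  let ?S = "Poly_Mapping.keys f \<union> Poly_Mapping.keys g"
  have "Poly_Mapping.keys (f + g) \<subseteq> ?S" by (rule Poly_Mapping.keys_add)
  then show ?thesis
    using free_action_superset[of ?S f \<phi> v k] free_action_superset[of ?S g \<phi> v k]
      free_action_superset[of ?S "f + g" \<phi> v k]
    by (simp add: lookup_add distrib_right sum.distrib)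
qed

lemma free_action_single:
  "free_action \<phi> (Poly_Mapping.single w c) v k = c * word_action \<phi> w v k"
  using free_action_superset[of "{w}" "Poly_Mapping.single w c" \<phi> v k] by simp

lemma free_action_scalar: "free_action \<phi> (free_scalar z) v k = z * v k"
  by (simp add: free_scalar_def free_action_single)

lemma free_action_gen: "free_action \<phi> (free_gen a) v = \<phi> a v"
  by (simp add: fun_eq_iff free_gen_def free_action_single)

lemma free_action_uminus: "free_action \<phi> (- f) v k = - free_action \<phi> f v k"
  using free_action_add[of \<phi> f "- f" v k] by (simp add: add_eq_0_iff2)

lemma free_action_diff: "free_action \<phi> (f - g) v k = free_action \<phi> f v k - free_action \<phi> g v k"
  using free_action_add[of \<phi> f "- g" v k] by (simp add: free_action_uminus)

text \<open>Linearity of each operator in the function is what makes the word-wise extension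
  multiplicative in \<open>free_action_mult\<close>.\<close>

locale pointwise_linear =
  fixes \<phi> :: "sl2 \<Rightarrow> ('k \<Rightarrow> complex) \<Rightarrow> 'k \<Rightarrow> complex"
  assumes linear_add: "\<phi> a (\<lambda>k. v k + w k) = (\<lambda>k. \<phi> a v k + \<phi> a w k)"
    and linear_scale: "\<phi> a (\<lambda>k. z * v k) = (\<lambda>k. z * \<phi> a v k)"
begin

lemma word_action_linear_add:
  "word_action \<phi> u (\<lambda>k. v k + w k) = (\<lambda>k. word_action \<phi> u v k + word_action \<phi> u w k)"
proof (cases u)
  case (Word x)
  have "foldr \<phi> x (\<lambda>k. v k + w k) = (\<lambda>k. foldr \<phi> x v k + foldr \<phi> x w k)"
    by (induction x) (simp_all add: linear_add)
  then show ?thesis by (simp add: Word)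
qed

lemma word_action_linear_scale:
  "word_action \<phi> u (\<lambda>k. z * v k) = (\<lambda>k. z * word_action \<phi> u v k)"
proof (cases u)
  case (Word x)
  have "foldr \<phi> x (\<lambda>k. z * v k) = (\<lambda>k. z * foldr \<phi> x v k)"
    by (induction x) (simp_all add: linear_scale)
  then show ?thesis by (simp add: Word)
qed

lemma word_action_zero: "word_action \<phi> u (\<lambda>k. 0) = (\<lambda>k. 0)"
  using word_action_linear_scale[of u 0 "\<lambda>k. 0"] by simp

lemma free_action_zero: "free_action \<phi> f (\<lambda>k. 0) = (\<lambda>k. 0)"
  by (simp add: fun_eq_iff free_action_def word_action_zero)

text \<open>Multiplicativity is proved one factor at a time; decomposing the right factor uses
  linearity of the word action in the vector.\<close>

lemma free_action_mult_single:
  "free_action \<phi> (Poly_Mapping.single w c * g) v = free_action \<phi> (Poly_Mapping.single w c) (free_action \<phi> g v)"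
proof (induction g rule: poly_mapping_single_induct)
  case zero
  then show ?case by (simp add: free_action_zero)
next
  case (add g u d)
  have single: "free_action \<phi> (Poly_Mapping.single u d) v = (\<lambda>k. d * word_action \<phi> u v k)" for u d v
    by (simp add: fun_eq_iff free_action_single)
  have sum: "free_action \<phi> (f + g) v = (\<lambda>k. free_action \<phi> f v k + free_action \<phi> g v k)" for f g v
    by (simp add: fun_eq_iff free_action_add)
  show ?case
    using add by (simp add: distrib_left mult_single sum single word_action_linear_add
        word_action_linear_scale word_action_add algebra_simps)
qed

lemma free_action_mult: "free_action \<phi> (f * g) v = free_action \<phi> f (free_action \<phi> g v)"
proof (induction f rule: poly_mapping_single_induct)
  case (add f w c)
  then show ?case
    by (simp add: fun_eq_iff distrib_right free_action_add free_action_mult_single)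
qed simp

end

text \<open>
  Writing \<open>v = (\<Sum>k. v k e\<^sub>k)\<close>, the element \<open>x - y\<close> has eigenvalue \<open>2 \<i> k\<close> on \<open>e\<^sub>k\<close>, while
  \<open>h + \<i> (x + y)\<close> maps \<open>e\<^sub>k\<close> to \<open>(\<mu> + 2 k + 1) e\<^sub>k\<^sub>+\<^sub>1\<close> and \<open>h - \<i> (x + y)\<close> maps it to
  \<open>(\<mu> - 2 k + 1) e\<^sub>k\<^sub>-\<^sub>1\<close>.
\<close>

definition spherical_action :: "complex \<Rightarrow> sl2 \<Rightarrow> (int \<Rightarrow> complex) \<Rightarrow> int \<Rightarrow> complex" where
  "spherical_action \<mu> a v k =
    coeff_C a * (2 * \<i> * of_int k * v k)
    + coeff_P a * ((\<mu> + 2 * of_int k - 1) * v (k - 1))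
    + coeff_Q a * ((\<mu> - 2 * of_int k - 1) * v (k + 1))"

interpretation spherical: pointwise_linear "spherical_action \<mu>" for \<mu>
  by standard (auto simp: spherical_action_def fun_eq_iff algebra_simps)

lemma spherical_action_add:
  "spherical_action \<mu> (a + b) v k = spherical_action \<mu> a v k + spherical_action \<mu> b v k"
  by (simp add: spherical_action_def coeff_add algebra_simps)

lemma spherical_action_scale:
  "spherical_action \<mu> (sl2_scale z a) v k = z * spherical_action \<mu> a v k"
  by (simp add: spherical_action_def coeff_scale algebra_simps)

text \<open>On the delta function at k, PQ and QP act by \<open>\<mu>\<^sup>2\<close> - (2 k - 1)^2
  and \<open>\<mu>\<^sup>2\<close> - (2 k + 1)^2. The difference 8 k is - 4 i times the eigenvalue 2
  i k, in accordance with [P, Q] = - 4 i C.\<close>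

lemma spherical_action_bracket:
  "spherical_action \<mu> (sl2_bracket a b) v k =
    spherical_action \<mu> a (spherical_action \<mu> b v) k - spherical_action \<mu> b (spherical_action \<mu> a v) k"
  by (simp add: spherical_action_def coeff_bracket algebra_simps)

lemma spherical_action_C: "spherical_action \<mu> sl2_C v k = 2 * \<i> * of_int k * v k"
  by (simp add: spherical_action_def coeff_defs sl2_C_def mat_of_sl2_simps)

text \<open>Conceptually c = QP - (C + i)^2 acts at k by (\<open>\<mu>\<^sup>2\<close> - (2 k +
  1)^2) + (2 k + 1)^2. The proof evaluates the operators of h, x and y directly.\<close>

lemma spherical_action_casimir:
  "free_action (spherical_action \<mu>) free_casimir v k = \<mu>\<^sup>2 * v k"
proof -
  have one: "free_action (spherical_action \<mu>) 1 v = v" for v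
    using free_action_scalar[of "spherical_action \<mu>" 1 v] by (simp add: fun_eq_iff)
  have four: "free_action (spherical_action \<mu>) 4 v = (\<lambda>k. 4 * v k)" for v
    using free_action_scalar[of "spherical_action \<mu>" 4 v] by (simp add: fun_eq_iff)
  have add: "free_action (spherical_action \<mu>) (f + g) v = (\<lambda>k. free_action (spherical_action \<mu>) f v k + free_action (spherical_action \<mu>) g v k)" for f g v
    by (simp add: fun_eq_iff free_action_add)
  have gens: "spherical_action \<mu> sl2_h v k =
      ((\<mu> + 2 * of_int k - 1) * v (k - 1) + (\<mu> - 2 * of_int k - 1) * v (k + 1)) / 2"
    "spherical_action \<mu> sl2_x v k = \<i> * (4 * of_int k * v k
      - (\<mu> + 2 * of_int k - 1) * v (k - 1) + (\<mu> - 2 * of_int k - 1) * v (k + 1)) / 4"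
    "spherical_action \<mu> sl2_y v k = \<i> * (- 4 * of_int k * v k
      - (\<mu> + 2 * of_int k - 1) * v (k - 1) + (\<mu> - 2 * of_int k - 1) * v (k + 1)) / 4" for v k
    by (simp_all add: spherical_action_def coeff_defs mat_of_sl2_simps algebra_simps)
  \<comment> \<open>Both h^2 and 4 y x carry a denominator 4, which the factor 4 clears.\<close>
  have "4 * free_action (spherical_action \<mu>) free_casimir v k = 4 * (\<mu>\<^sup>2 * v k)"
    by (simp add: free_casimir_def power2_eq_square spherical.free_action_mult add one four
        free_action_gen, simp add: gens, simp add: algebra_simps add_divide_distrib diff_divide_distrib)
  then show ?thesis by simp
qed

section \<open>Quotients of the free algebra\<close>

text \<open>Presents a module as the quotient of the free algebra by \<open>K\<close> through a
  surjection \<open>q\<close>, so that the nested cosets need unfolding only when the locale is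
  interpreted.\<close>

locale free_sl2_quotient =
  fixes V :: "('v, 'm) sl2_module_scheme" (structure) and q :: "free_sl2 \<Rightarrow> 'v" and K :: "free_sl2 set"
  assumes left_ideal_K: "left_ideal K"
    and relations_K: "U_relations \<subseteq> annihilator K"
    and q_eq_iff: "q f = q g \<longleftrightarrow> f - g \<in> K"
    and carrier_q: "carrier V = range q"
    and zero_q: "\<zero>\<^bsub>V\<^esub> = q 0"
    and add_q: "q f \<oplus>\<^bsub>V\<^esub> q g = q (f + g)"
    and smult_q: "z \<odot>\<^bsub>V\<^esub> q f = q (free_scalar z * f)"
    and act_q: "act V a (q f) = q (free_gen a * f)"
begin

lemma abelian_group_V: "abelian_group V"
proof (rule abelian_groupI)
  fix x assume "x \<in> carrier V"
  then obtain f where "x = q f" by (auto simp: carrier_q)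
  then have "q (- f) \<oplus>\<^bsub>V\<^esub> x = \<zero>\<^bsub>V\<^esub>" by (simp add: add_q zero_q)
  then show "\<exists>y\<in>carrier V. y \<oplus>\<^bsub>V\<^esub> x = \<zero>\<^bsub>V\<^esub>" by (auto simp: carrier_q)
qed (auto simp: carrier_q zero_q add_q ac_simps)

lemma minus_q: "q f \<ominus>\<^bsub>V\<^esub> q g = q (f - g)"
proof -
  interpret abelian_group V by (rule abelian_group_V)
  have "\<ominus>\<^bsub>V\<^esub> q g = q (- g)"
    by (rule minus_equality) (auto simp: carrier_q add_q zero_q)
  then show ?thesis by (simp add: a_minus_def add_q)
qed

lemma q_annihilator: "f - g \<in> annihilator K \<Longrightarrow> q (f * u) = q (g * u)"
  using annihilatorD[of "f - g" K u] by (simp add: q_eq_iff left_diff_distrib)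

lemma sl2_module_V: "sl2_module V"
proof (intro sl2_module.intro sl2_module_axioms.intro)
  show "Module.module complex_ring V"
    by (rule moduleI[OF cring_from_type_algebra abelian_group_V])
      (auto simp: carrier_q smult_q add_q ring_of_type_algebra_def
        free_scalar_add free_scalar_mult distrib_left distrib_right mult.assoc)
next
  fix v a assume "v \<in> carrier V"
  then show "act V a v \<in> carrier V" by (auto simp: carrier_q act_q)
next
  fix v w a assume "v \<in> carrier V" "w \<in> carrier V"
  then show "act V a (v \<oplus>\<^bsub>V\<^esub> w) = act V a v \<oplus>\<^bsub>V\<^esub> act V a w"
    by (auto simp: carrier_q act_q add_q distrib_left)
next
  fix v a z assume "v \<in> carrier V"
  then show "act V a (z \<odot>\<^bsub>V\<^esub> v) = z \<odot>\<^bsub>V\<^esub> act V a v"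
    by (auto simp: carrier_q act_q smult_q free_scalar_commute simp flip: mult.assoc)
next
  fix v a b assume "v \<in> carrier V"
  then show "act V (a + b) v = act V a v \<oplus>\<^bsub>V\<^esub> act V b v"
    using q_annihilator[OF free_gen_relations(1)[OF relations_K]]
    by (auto simp: carrier_q act_q add_q distrib_right)
next
  fix v z a assume "v \<in> carrier V"
  then show "act V (sl2_scale z a) v = z \<odot>\<^bsub>V\<^esub> act V a v"
    using q_annihilator[OF free_gen_relations(2)[OF relations_K]]
    by (auto simp: carrier_q act_q smult_q mult.assoc)
next
  fix v a b assume "v \<in> carrier V"
  then obtain f where "v = q f" by (auto simp: carrier_q)
  moreover have "(free_gen (sl2_bracket a b) - (free_gen a * free_gen b - free_gen b * free_gen a)) \<in> annihilator K"
    using left_ideal_uminus[OF left_ideal_annihilator[OF left_ideal_K] free_gen_relations(3)[OF relations_K, of a b]]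
    by simp
  ultimately show "act V (sl2_bracket a b) v = act V a (act V b v) \<ominus>\<^bsub>V\<^esub> act V b (act V a v)"
    using q_annihilator by (simp add: act_q minus_q left_diff_distrib mult.assoc)
qed

text \<open>The preimage is closed under scalars, sums and generators, which give all left
  multiplications by \<open>free_sl2_induct\<close>.\<close>

lemma left_ideal_submodule:
  assumes "sl2_submodule W V"
  shows "left_ideal {f. q f \<in> W}"
proof (rule left_idealI)
  interpret W: submodule W complex_ring V
    using assms by (simp add: sl2_submodule_def)
  \<comment> \<open>\<open>submodule\<close> extends the subgroup locale of the additive monoid, so
    \<open>one_closed\<close> speaks of zero and \<open>m_closed\<close> of sums.\<close>
  have zero: "q 0 \<in> W"
    using W.one_closed by (simp add: zero_q)
  have add: "q (f + g) \<in> W" if "q f \<in> W" "q g \<in> W" for f g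
    using W.m_closed[OF that] by (simp add: add_q)
  show "0 \<in> {f. q f \<in> W}" using zero by simp
  show "f + g \<in> {f. q f \<in> W}" if "f \<in> {f. q f \<in> W}" "g \<in> {f. q f \<in> W}" for f g
    using add that by simp
  have "q (a * f) \<in> W" if f: "q f \<in> W" for a f
  proof (induction a rule: free_sl2_induct)
    case (scalar z)
    then show ?case
      using W.smult_closed[of z "q f"] f by (simp add: smult_q ring_of_type_algebra_def)
  next
    case (add a b)
    then show ?case using \<open>\<And>f g. q f \<in> W \<Longrightarrow> q g \<in> W \<Longrightarrow> q (f + g) \<in> W\<close> by (simp add: distrib_right)
  next
    case (gen b a)
    then have "act V b (q (a * f)) \<in> W" using assms by (simp add: sl2_submodule_def)
    then show ?case by (simp add: act_q mult.assoc)
  qed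
  then show "a * f \<in> {f. q f \<in> W}" if "f \<in> {f. q f \<in> W}" for a f
    using that by simp
qed

text \<open>Submodules correspond to left ideals above \<open>K\<close> by taking preimages under
  \<open>q\<close>, and the class of 1 is nonzero.\<close>

lemma simple_if_maximal:
  assumes "1 \<notin> K" and maximal: "\<And>W. left_ideal W \<Longrightarrow> K \<subseteq> W \<Longrightarrow> W = K \<or> W = UNIV"
  shows "simple_sl2_module V"
  unfolding simple_sl2_module_def
proof (intro conjI allI impI)
  show "sl2_module V" by (rule sl2_module_V)
  have "q 1 \<noteq> q 0" using assms(1) by (simp add: q_eq_iff)
  then show "carrier V \<noteq> {\<zero>\<^bsub>V\<^esub>}" by (auto simp: carrier_q zero_q)
  fix W assume W: "sl2_submodule W V"
  let ?W = "{f. q f \<in> W}"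
  interpret W: submodule W complex_ring V
    using W by (simp add: sl2_submodule_def)
  have W_eq: "W = q ` ?W"
    using W.subset by (auto simp: carrier_q)
  have "q f = q 0" if "f \<in> K" for f using that by (simp add: q_eq_iff)
  moreover have zero: "q 0 \<in> W" using W.one_closed by (simp add: zero_q)
  ultimately have "K \<subseteq> ?W" by auto
  from maximal[OF left_ideal_submodule[OF W] this] show "W = {\<zero>\<^bsub>V\<^esub>} \<or> W = carrier V"
  proof
    assume "?W = K"
    then have "W \<subseteq> {q 0}" using W_eq \<open>\<And>f. f \<in> K \<Longrightarrow> q f = q 0\<close> by auto
    then show ?thesis using zero by (auto simp: zero_q)
  next
    assume "?W = UNIV"
    then show ?thesis using W_eq by (simp add: carrier_q)
  qed
qed

end

section \<open>Cosets and additive subgroups in rings\<close>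

lemma (in abelian_subgroup) a_r_coset_eq_iff:
  assumes "x \<in> carrier G" "y \<in> carrier G"
  shows "H +> x = H +> y \<longleftrightarrow> x \<ominus> y \<in> H"
proof -
  have "H +> x = H +> y \<longleftrightarrow> x \<in> H +> y"
    using assms a_repr_independence' a_repr_independenceD by metis
  then show ?thesis using assms by (simp add: a_rcos_module minus_eq)
qed

lemma (in ring_hom_ring) hom_minus:
  assumes "x \<in> carrier R" "y \<in> carrier R"
  shows "h (x \<ominus>\<^bsub>R\<^esub> y) = h x \<ominus>\<^bsub>S\<^esub> h y"
  using assms by (simp add: R.minus_eq S.minus_eq)

lemma (in ring) additive_subgroup_criterion:
  assumes "H \<subseteq> carrier R" "\<zero> \<in> H" "\<And>x y. x \<in> H \<Longrightarrow> y \<in> H \<Longrightarrow> x \<oplus> y \<in> H"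
    and inverse: "\<And>x. x \<in> H \<Longrightarrow> \<exists>y\<in>H. y \<oplus> x = \<zero>"
  shows "additive_subgroup H R"
proof (rule additive_subgroupI, rule add.subgroupI)
  fix x assume "x \<in> H"
  then obtain y where "y \<in> H" "y \<oplus> x = \<zero>" using inverse by blast
  then have "\<ominus> x = y" using \<open>x \<in> H\<close> assms(1) minus_equality by blast
  then show "\<ominus> x \<in> H" using \<open>y \<in> H\<close> by simp
qed (use assms in auto)

lemma (in ideal) a_r_coset_in_ideal_iff:
  assumes "x \<in> carrier R"
  shows "I +> x = I \<longleftrightarrow> x \<in> I"
  using assms a_rcos_const a_rcos_self by blast

text \<open>The union defining the action runs over all representatives; as \<open>L\<close> absorbs
  left multiplication, they all give the same coset.\<close>

lemma left_quotient_smult: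
  fixes R :: "'r ring" (structure)
  assumes "ring R" and L: "additive_subgroup L R" and closed: "\<And>r x. r \<in> carrier R \<Longrightarrow> x \<in> L \<Longrightarrow> r \<otimes> x \<in> L"
    and r: "r \<in> carrier R" and v: "v \<in> carrier R"
  shows "r \<odot>\<^bsub>left_quotient R L\<^esub> (L +> v) = L +> (r \<otimes> v)"
proof -
  interpret ring R by fact
  interpret abelian_subgroup L R
    using L by (simp add: abelian_subgroupI3 abelian_group_axioms)
  have "L +> (r \<otimes> w) = L +> (r \<otimes> v)" if w: "w \<in> L +> v" for w
  proof -
    obtain x where x: "x \<in> L" "w = x \<oplus> v"
      using w by (auto simp: a_r_coset_def')
    then have "r \<otimes> w = r \<otimes> x \<oplus> r \<otimes> v" using r v by (simp add: r_distr)
    then have "r \<otimes> w \<in> L +> (r \<otimes> v)"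
      using closed[OF r x(1)] by (auto simp: a_r_coset_def')
    then show ?thesis
      using a_repr_independence' r v by (metis m_closed)
  qed
  moreover have "v \<in> L +> v" using v by (rule a_rcos_self)
  ultimately have "(\<Union>w\<in>L +> v. L +> (r \<otimes> w)) = L +> (r \<otimes> v)" by blast
  then show ?thesis by (simp add: left_quotient_def)
qed

section \<open>The free algebra, U(sl2) and its quotient by the Casimir relation\<close>

lemma free_ring_simps [simp]:
  "carrier free_ring = UNIV" "\<zero>\<^bsub>free_ring\<^esub> = 0" "\<one>\<^bsub>free_ring\<^esub> = 1"
  "f \<oplus>\<^bsub>free_ring\<^esub> g = f + g" "f \<otimes>\<^bsub>free_ring\<^esub> g = f * g"
  by (simp_all add: ring_of_type_algebra_def)

lemma ring_free_ring: "ring free_ring"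
proof (rule ringI)
  show "abelian_group free_ring"
    by (rule abelian_groupI) (auto simp: ac_simps intro: exI[of _ "- x" for x])
  show "Group.monoid free_ring"
    by (rule monoidI) (auto simp: mult.assoc)
qed (auto simp: algebra_simps)

interpretation free_ring: ring free_ring
  by (rule ring_free_ring)

lemma free_ring_minus [simp]: "f \<ominus>\<^bsub>free_ring\<^esub> g = f - g"
proof -
  have "\<ominus>\<^bsub>free_ring\<^esub> g = - g"
    by (rule free_ring.minus_equality) auto
  then show ?thesis by (simp add: a_minus_def)
qed

lemma ideal_U_ideal: "ideal U_ideal free_ring"
  unfolding U_ideal_def by (rule free_ring.genideal_ideal) simp

definition U_proj :: "free_sl2 \<Rightarrow> free_sl2 set" where
  "U_proj f = U_ideal +>\<^bsub>free_ring\<^esub> f"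

lemma ring_hom_U_proj: "ring_hom_ring free_ring U_sl2 U_proj"
  using ideal.rcos_ring_hom_ring[OF ideal_U_ideal] by (simp add: U_sl2_def U_proj_def[abs_def])

interpretation U: ring U_sl2
  by (rule ring_hom_ring.axioms(2)[OF ring_hom_U_proj])

lemma carrier_U_sl2: "carrier U_sl2 = range U_proj"
  by (auto simp: U_sl2_def FactRing_def A_RCOSETS_def' U_proj_def)

lemma U_proj_carrier [simp]: "U_proj f \<in> carrier U_sl2"
  by (simp add: carrier_U_sl2)

lemma U_proj_hom:
  "U_proj (f + g) = U_proj f \<oplus>\<^bsub>U_sl2\<^esub> U_proj g"
  "U_proj (f - g) = U_proj f \<ominus>\<^bsub>U_sl2\<^esub> U_proj g"
  "U_proj (f * g) = U_proj f \<otimes>\<^bsub>U_sl2\<^esub> U_proj g"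
  "U_proj 1 = \<one>\<^bsub>U_sl2\<^esub>" "U_proj 0 = \<zero>\<^bsub>U_sl2\<^esub>"
proof -
  interpret ring_hom_ring free_ring U_sl2 U_proj by (rule ring_hom_U_proj)
  show "U_proj (f + g) = U_proj f \<oplus>\<^bsub>U_sl2\<^esub> U_proj g"
    "U_proj (f - g) = U_proj f \<ominus>\<^bsub>U_sl2\<^esub> U_proj g"
    "U_proj (f * g) = U_proj f \<otimes>\<^bsub>U_sl2\<^esub> U_proj g"
    "U_proj 1 = \<one>\<^bsub>U_sl2\<^esub>" "U_proj 0 = \<zero>\<^bsub>U_sl2\<^esub>"
    using hom_add[of f g] hom_mult[of f g] hom_one hom_zero hom_minus[of f g] by simp_all
qed

lemma U_proj_eq_iff: "U_proj f = U_proj g \<longleftrightarrow> f - g \<in> U_ideal"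
proof -
  have "abelian_subgroup U_ideal free_ring"
    by (intro abelian_subgroupI3 ideal.axioms(1) ideal_U_ideal free_ring.abelian_group_axioms)
  from abelian_subgroup.a_r_coset_eq_iff[OF this, of f g] show ?thesis
    by (simp add: U_proj_def)
qed

lemma U_gen_U_proj: "U_gen a = U_proj (free_gen a)"
  by (simp add: U_gen_def U_proj_def)

lemma U_scalar_U_proj: "U_scalar z = U_proj (free_scalar z)"
  by (simp add: U_scalar_def U_proj_def)

lemma casimir_U_proj: "casimir = U_proj free_casimir"
  by (simp add: casimir_def free_casimir_def U_gen_U_proj U_scalar_U_proj numeral_2_eq_2
      power2_eq_square U.nat_pow_Suc flip: U_proj_hom(1,3,4))

lemma ideal_I_lam: "ideal (I_lam l) U_sl2"
  unfolding I_lam_def casimir_U_proj U_scalar_U_proj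
  by (rule U.genideal_ideal) (simp flip: U_proj_hom(2))

lemma casimir_I_lam: "U_proj (free_casimir - free_scalar ((l + 1)\<^sup>2)) \<in> I_lam l"
  unfolding I_lam_def casimir_U_proj U_scalar_U_proj U_proj_hom
  by (rule U.genideal_self') simp

text \<open>The composite of both quotient maps; elements of \<open>U_lam l\<close> are handled
  through representatives in the free algebra.\<close>

definition lam_proj :: "complex \<Rightarrow> free_sl2 \<Rightarrow> free_sl2 set set" where
  "lam_proj l f = U_lam_proj l (U_proj f)"

lemma ring_hom_lam_proj: "ring_hom_ring free_ring (U_lam l) (lam_proj l)"
proof -
  have "U_lam_proj l \<in> ring_hom U_sl2 (U_lam l)"
    using ideal.rcos_ring_hom[OF ideal_I_lam] by (simp add: U_lam_def U_lam_proj_def[abs_def])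
  then have "U_lam_proj l \<circ> U_proj \<in> ring_hom free_ring (U_lam l)"
    by (rule ring_hom_trans[OF ring_hom_ring.homh[OF ring_hom_U_proj]])
  moreover have "ring (U_lam l)"
    using ideal.quotient_is_ring[OF ideal_I_lam] by (simp add: U_lam_def)
  ultimately show ?thesis
    by (intro ring_hom_ringI2 ring_free_ring) (simp_all add: lam_proj_def[abs_def] comp_def)
qed

interpretation lam: ring "U_lam l" for l
  by (rule ring_hom_ring.axioms(2)[OF ring_hom_lam_proj])

lemma carrier_U_lam: "carrier (U_lam l) = range (lam_proj l)"
  by (auto simp: U_lam_def FactRing_def A_RCOSETS_def' lam_proj_def U_lam_proj_def carrier_U_sl2)

lemma lam_proj_carrier [simp]: "lam_proj l f \<in> carrier (U_lam l)"
  by (simp add: carrier_U_lam)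

lemma lam_proj_hom:
  "lam_proj l (f + g) = lam_proj l f \<oplus>\<^bsub>U_lam l\<^esub> lam_proj l g"
  "lam_proj l (f - g) = lam_proj l f \<ominus>\<^bsub>U_lam l\<^esub> lam_proj l g"
  "lam_proj l (f * g) = lam_proj l f \<otimes>\<^bsub>U_lam l\<^esub> lam_proj l g"
  "lam_proj l 1 = \<one>\<^bsub>U_lam l\<^esub>" "lam_proj l 0 = \<zero>\<^bsub>U_lam l\<^esub>"
proof -
  interpret ring_hom_ring free_ring "U_lam l" "lam_proj l" by (rule ring_hom_lam_proj)
  show "lam_proj l (f + g) = lam_proj l f \<oplus>\<^bsub>U_lam l\<^esub> lam_proj l g"
    "lam_proj l (f - g) = lam_proj l f \<ominus>\<^bsub>U_lam l\<^esub> lam_proj l g"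
    "lam_proj l (f * g) = lam_proj l f \<otimes>\<^bsub>U_lam l\<^esub> lam_proj l g"
    "lam_proj l 1 = \<one>\<^bsub>U_lam l\<^esub>" "lam_proj l 0 = \<zero>\<^bsub>U_lam l\<^esub>"
    using hom_add[of f g] hom_mult[of f g] hom_one hom_zero hom_minus[of f g] by simp_all
qed

lemma lam_proj_eq_zero_iff: "lam_proj l f = \<zero>\<^bsub>U_lam l\<^esub> \<longleftrightarrow> U_proj f \<in> I_lam l"
  using ideal.a_r_coset_in_ideal_iff[OF ideal_I_lam, of "U_proj f"]
  by (simp add: lam_proj_def U_lam_proj_def U_lam_def FactRing_def)

lemma lam_proj_relations: "r \<in> U_relations \<Longrightarrow> lam_proj l r = \<zero>\<^bsub>U_lam l\<^esub>"
proof -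
  assume "r \<in> U_relations"
  then have "r \<in> U_ideal"
    unfolding U_ideal_def using free_ring.genideal_self[of U_relations] by auto
  then have "U_proj r = U_proj 0" by (simp add: U_proj_eq_iff)
  then show ?thesis by (metis lam_proj_def lam_proj_hom(5))
qed

lemma lam_proj_casimir: "lam_proj l (free_casimir - free_scalar ((l + 1)\<^sup>2)) = \<zero>\<^bsub>U_lam l\<^esub>"
  by (simp add: lam_proj_eq_zero_iff casimir_I_lam)

text \<open>Minimality of generated ideals is used twice: \<open>U_ideal\<close> lies in
  \<open>N\<close>, and \<open>I_lam l\<close> lies in the image of \<open>N\<close> in U(sl2). With
  \<open>N\<close> the kernel of a representation, this lets the representation factor through
  \<open>U_lam l\<close>.\<close>

lemma lam_proj_kernel_subset:
  assumes N: "left_ideal N" "\<And>f u. f \<in> N \<Longrightarrow> f * u \<in> N"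
    and rel: "U_relations \<subseteq> N" and cas: "free_casimir - free_scalar ((l + 1)\<^sup>2) \<in> N"
    and f: "lam_proj l f = \<zero>\<^bsub>U_lam l\<^esub>"
  shows "f \<in> N"
proof -
  note N_closed = left_ideal_add[OF N(1)] left_ideal_uminus[OF N(1)] left_ideal_mult[OF N(1)] N(2)
  have "additive_subgroup N free_ring"
  proof (rule free_ring.additive_subgroup_criterion)
    show "\<exists>y\<in>N. y \<oplus>\<^bsub>free_ring\<^esub> x = \<zero>\<^bsub>free_ring\<^esub>" if "x \<in> N" for x
      using N_closed(2)[OF that] by (intro bexI[of _ "- x"]) auto
  qed (simp_all add: left_ideal_zero[OF N(1)] N_closed)
  then have "ideal N free_ring"
    by (intro idealI ring_free_ring additive_subgroup.a_subgroup) (simp_all add: N_closed)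
  then have U_N: "U_ideal \<subseteq> N"
    unfolding U_ideal_def by (rule free_ring.genideal_minimal[OF _ rel])
  have "additive_subgroup (U_proj ` N) U_sl2"
  proof (rule U.additive_subgroup_criterion)
    show "\<zero>\<^bsub>U_sl2\<^esub> \<in> U_proj ` N"
      using left_ideal_zero[OF N(1)] by (metis U_proj_hom(5) imageI)
    show "x \<oplus>\<^bsub>U_sl2\<^esub> y \<in> U_proj ` N" if "x \<in> U_proj ` N" "y \<in> U_proj ` N" for x y
      using that N_closed(1) by (auto simp flip: U_proj_hom(1))
    show "\<exists>y\<in>U_proj ` N. y \<oplus>\<^bsub>U_sl2\<^esub> x = \<zero>\<^bsub>U_sl2\<^esub>" if x: "x \<in> U_proj ` N" for x
    proof -
      obtain g where g: "g \<in> N" "x = U_proj g" using x by blast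
      then have "U_proj (- g) \<oplus>\<^bsub>U_sl2\<^esub> x = \<zero>\<^bsub>U_sl2\<^esub>" by (simp flip: U_proj_hom(1,5))
      then show ?thesis using N_closed(2)[OF g(1)] by blast
    qed
  qed auto
  then have "ideal (U_proj ` N) U_sl2"
  proof (intro idealI U.ring_axioms additive_subgroup.a_subgroup)
    fix a x assume "a \<in> U_proj ` N" "x \<in> carrier U_sl2"
    then obtain g u where "g \<in> N" "a = U_proj g" "x = U_proj u"
      by (auto simp: carrier_U_sl2)
    then show "x \<otimes>\<^bsub>U_sl2\<^esub> a \<in> U_proj ` N" "a \<otimes>\<^bsub>U_sl2\<^esub> x \<in> U_proj ` N"
      using N_closed(3,4) by (simp_all flip: U_proj_hom(3))
  qed
  then have "I_lam l \<subseteq> U_proj ` N"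
    unfolding I_lam_def casimir_U_proj U_scalar_U_proj
    by (rule U.genideal_minimal) (use cas in \<open>auto simp flip: U_proj_hom(2)\<close>)
  \<comment> \<open>The class of \<open>f\<close> in U(sl2) is that of some \<open>g\<close> in
    \<open>N\<close>; the error lies in \<open>U_ideal\<close>, which \<open>N\<close>
    contains.\<close>
  then obtain g where "g \<in> N" "f - g \<in> U_ideal"
    using f by (auto simp: lam_proj_eq_zero_iff U_proj_eq_iff)
  then show ?thesis
    using U_N left_ideal_add[OF N(1), of "f - g" g] by auto
qed

section \<open>The left ideal generated by C and the module\<close>

definition C_left_ideal :: "complex \<Rightarrow> free_sl2 set set set" where
  "C_left_ideal l = PIdl\<^bsub>U_lam l\<^esub> (lam_proj l (free_gen sl2_C))"

definition free_C_left_ideal :: "complex \<Rightarrow> free_sl2 set" where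
  "free_C_left_ideal l = {f. lam_proj l f \<in> C_left_ideal l}"

lemma C_left_ideal_eq: "C_left_ideal l = range (\<lambda>u. lam_proj l (u * free_gen sl2_C))"
  by (auto simp: C_left_ideal_def cgenideal_def carrier_U_lam lam_proj_hom)

lemma C_left_ideal_closed:
  "r \<in> carrier (U_lam l) \<Longrightarrow> x \<in> C_left_ideal l \<Longrightarrow> r \<otimes>\<^bsub>U_lam l\<^esub> x \<in> C_left_ideal l"
  by (auto simp: C_left_ideal_eq carrier_U_lam simp flip: lam_proj_hom(3) mult.assoc)

lemma additive_subgroup_C_left_ideal: "additive_subgroup (C_left_ideal l) (U_lam l)"
proof (rule lam.additive_subgroup_criterion)
  show "C_left_ideal l \<subseteq> carrier (U_lam l)"
    by (auto simp: C_left_ideal_eq)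
  show "\<zero>\<^bsub>U_lam l\<^esub> \<in> C_left_ideal l"
    unfolding C_left_ideal_eq by (rule image_eqI[of _ _ 0]) (simp_all add: lam_proj_hom(5))
  show "x \<oplus>\<^bsub>U_lam l\<^esub> y \<in> C_left_ideal l" if "x \<in> C_left_ideal l" "y \<in> C_left_ideal l" for x y
    using that unfolding C_left_ideal_eq by (auto simp flip: lam_proj_hom(1) distrib_right)
  show "\<exists>y\<in>C_left_ideal l. y \<oplus>\<^bsub>U_lam l\<^esub> x = \<zero>\<^bsub>U_lam l\<^esub>" if x: "x \<in> C_left_ideal l" for x
  proof -
    obtain u where "x = lam_proj l (u * free_gen sl2_C)"
      using x by (auto simp: C_left_ideal_eq)
    then have "lam_proj l (- u * free_gen sl2_C) \<oplus>\<^bsub>U_lam l\<^esub> x = \<zero>\<^bsub>U_lam l\<^esub>"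
      by (simp flip: lam_proj_hom(1,5))
    then show ?thesis unfolding C_left_ideal_eq by blast
  qed
qed

interpretation C_left_ideal: abelian_subgroup "C_left_ideal l" "U_lam l" for l
  by (intro abelian_subgroupI3 additive_subgroup_C_left_ideal lam.abelian_group_axioms)

lemma left_ideal_free_C: "left_ideal (free_C_left_ideal l)"
proof (rule left_idealI)
  show "0 \<in> free_C_left_ideal l"
    by (simp add: free_C_left_ideal_def lam_proj_hom)
  show "x + y \<in> free_C_left_ideal l" if "x \<in> free_C_left_ideal l" "y \<in> free_C_left_ideal l" for x y
    using that by (simp add: free_C_left_ideal_def lam_proj_hom)
  show "a * x \<in> free_C_left_ideal l" if "x \<in> free_C_left_ideal l" for a x
    using that by (simp add: free_C_left_ideal_def lam_proj_hom C_left_ideal_closed)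
qed

text \<open>What vanishes in \<open>U_lam l\<close> still vanishes after right multiplication, hence
  kills the whole quotient.\<close>

lemma annihilator_free_C:
  assumes "lam_proj l f = \<zero>\<^bsub>U_lam l\<^esub>"
  shows "f \<in> annihilator (free_C_left_ideal l)"
  using assms by (simp add: annihilator_def free_C_left_ideal_def lam_proj_hom)

interpretation free_C: spherical_left_ideal "free_C_left_ideal l" "l + 1" for l
proof
  show "left_ideal (free_C_left_ideal l)" by (rule left_ideal_free_C)
  show "U_relations \<subseteq> annihilator (free_C_left_ideal l)"
    using annihilator_free_C lam_proj_relations by blast
  show "free_casimir - free_scalar ((l + 1)\<^sup>2) \<in> annihilator (free_C_left_ideal l)"
    by (rule annihilator_free_C) (rule lam_proj_casimir)
  have "lam_proj l (1 * free_gen sl2_C) \<in> C_left_ideal l"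
    unfolding C_left_ideal_eq by (rule rangeI)
  then show "free_gen sl2_C \<in> free_C_left_ideal l"
    by (simp add: free_C_left_ideal_def)
qed

text \<open>An equation 1 = u C in \<open>U_lam l\<close>, applied to the delta function at 0, whose
  eigenvalue under C is 0, would make that function vanish.\<close>

lemma one_notin_free_C: "1 \<notin> free_C_left_ideal l"
proof
  let ?\<rho> = "free_action (spherical_action (l + 1))"
  \<comment> \<open>The kernel of the representation, a two-sided ideal to which
    \<open>lam_proj_kernel_subset\<close> applies.\<close>
  define N where "N = {f. \<forall>v. ?\<rho> f v = (\<lambda>k. 0)}"
  define e :: "int \<Rightarrow> complex" where "e k = (if k = 0 then 1 else 0)" for k
  assume "1 \<in> free_C_left_ideal l"
  then obtain u where "lam_proj l 1 = lam_proj l (u * free_gen sl2_C)"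
    by (auto simp: free_C_left_ideal_def C_left_ideal_eq)
  then have "lam_proj l (1 - u * free_gen sl2_C) = \<zero>\<^bsub>U_lam l\<^esub>"
    unfolding lam_proj_hom(2) by (simp add: lam.r_right_minus_eq)
  then have "1 - u * free_gen sl2_C \<in> N"
  \<comment> \<open>The rotation moves the vanishing in \<open>U_lam l\<close> to the front, where
    the chained fact is consumed.\<close>
  proof (rule lam_proj_kernel_subset[rotated -1])
    show "left_ideal N"
      by (rule left_idealI) (simp_all add: N_def free_action_add spherical.free_action_mult
          spherical.free_action_zero, simp_all add: fun_eq_iff free_action_add)
    show "f * u \<in> N" if "f \<in> N" for f u
      using that by (simp add: N_def spherical.free_action_mult)
    show "U_relations \<subseteq> N"
      by (auto simp: U_relations_def N_def fun_eq_iff free_action_diff free_action_add free_action_scalar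
          free_action_gen spherical.free_action_mult spherical_action_add spherical_action_scale
          spherical_action_bracket)
    show "free_casimir - free_scalar ((l + 1)\<^sup>2) \<in> N"
      by (simp add: N_def fun_eq_iff free_action_diff free_action_scalar spherical_action_casimir)
  qed
  then have "?\<rho> (1 - u * free_gen sl2_C) e = (\<lambda>k. 0)" by (simp add: N_def)
  moreover have "?\<rho> (free_gen sl2_C) e = (\<lambda>k. 0)"
    by (simp add: fun_eq_iff free_action_gen spherical_action_C e_def)
  then have "?\<rho> (u * free_gen sl2_C) e = (\<lambda>k. 0)"
    by (simp add: spherical.free_action_mult spherical.free_action_zero)
  ultimately have "?\<rho> (free_scalar 1) e = (\<lambda>k. 0)"
    by (simp add: fun_eq_iff free_action_diff)
  then have "e 0 = 0" by (metis free_action_scalar mult_1)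
  then show False by (simp add: e_def)
qed

definition M_proj :: "complex \<Rightarrow> free_sl2 \<Rightarrow> free_sl2 set set set" where
  "M_proj l f = C_left_ideal l +>\<^bsub>U_lam l\<^esub> lam_proj l f"

lemma M_C_eq: "M_C l = sl2_restrict l (left_quotient (U_lam l) (C_left_ideal l))"
  by (simp add: M_C_def C_left_ideal_def lam_proj_def U_gen_U_proj)

lemma left_quotient_M_proj:
  "lam_proj l g \<odot>\<^bsub>left_quotient (U_lam l) (C_left_ideal l)\<^esub> M_proj l f = M_proj l (g * f)"
  unfolding M_proj_def lam_proj_hom
  by (rule left_quotient_smult[OF lam.ring_axioms additive_subgroup_C_left_ideal C_left_ideal_closed]) simp_all

interpretation M: free_sl2_quotient "M_C l" "M_proj l" "free_C_left_ideal l" for l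
proof
  show "left_ideal (free_C_left_ideal l)" by (rule left_ideal_free_C)
  show "U_relations \<subseteq> annihilator (free_C_left_ideal l)" by (rule free_C.relations_K)
  show "M_proj l f = M_proj l g \<longleftrightarrow> f - g \<in> free_C_left_ideal l" for f g
    by (simp add: M_proj_def C_left_ideal.a_r_coset_eq_iff free_C_left_ideal_def lam_proj_hom)
  show "carrier (M_C l) = range (M_proj l)"
    by (auto simp: M_C_eq sl2_restrict_def left_quotient_def A_RCOSETS_def' M_proj_def carrier_U_lam)
  show "\<zero>\<^bsub>M_C l\<^esub> = M_proj l 0"
    by (simp add: M_C_eq sl2_restrict_def left_quotient_def M_proj_def lam_proj_hom
        C_left_ideal.a_rcos_const)
  show "M_proj l f \<oplus>\<^bsub>M_C l\<^esub> M_proj l g = M_proj l (f + g)" for f g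
    by (simp add: M_C_eq sl2_restrict_def left_quotient_def M_proj_def lam_proj_hom
        C_left_ideal.a_rcos_sum)
  show "z \<odot>\<^bsub>M_C l\<^esub> M_proj l f = M_proj l (free_scalar z * f)" for z f
    by (simp add: M_C_eq sl2_restrict_def U_scalar_U_proj left_quotient_M_proj flip: lam_proj_def)
  show "act (M_C l) a (M_proj l f) = M_proj l (free_gen a * f)" for a f
    by (simp add: M_C_eq sl2_restrict_def U_gen_U_proj left_quotient_M_proj flip: lam_proj_def)
qed

theorem theorem3p1:
  fixes l :: complex
  assumes "l \<notin> {2 * of_int n |n :: int. True}"
  shows "simple_sl2_module (M_C l)"
proof (rule M.simple_if_maximal[OF one_notin_free_C])
  fix W assume "left_ideal W" "free_C_left_ideal l \<subseteq> W"
  then interpret spherical_left_ideal_above "free_C_left_ideal l" "l + 1" W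
    by unfold_locales
  \<comment> \<open>The maximality argument has parameter \<open>\<mu>\<close> =
    \<open>l + 1\<close>, which must not be odd.\<close>
  have "l + 1 \<noteq> 2 * of_int n + 1" for n :: int
    using assms by auto
  then show "W = free_C_left_ideal l \<or> W = UNIV" by (rule maximal)
qed

end
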